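(* Let $1\le p<n$. For $A,B\in S^+(p,n)$ such that the largest principal angle between $\mathrm{range}(A)$ and $\mathrm{range}(B)$ satisfies $\theta_p\ne\pi/2$, the mean $A\circ B$ possesses the following properties. 1. Joint homogeneity: $(\alpha A)\circ(\beta B)=(\alpha\beta)^{1/2}\,(A\circ B)$ for all $\alpha,\beta>0$. 2. Permutation invariance: $A\circ B=B\circ A$. 3. Monotonicity: if $A_0,B_0\in S^+(p,n)$ satisfy $A\le A_0$ and $B\le B_0$ (i.e. $A_0-A$ and $B_0-B$ are positive semidefinite), then the means are comparable and $A\circ B\le A_0\circ B_0$. 4. Congruence invariance: for any $\mu\in\mathbb R\setminus\{0\}$ and $P\in O(n)$, $(\mu P^TA\mu P)\circ(\mu P^TB\mu P)=\mu P^T(A\circ B)\mu P$. 5. Self-duality: $(A\circ B)^\dagger=A^\dagger\circ B^\dagger$, where $\dagger$ denotes (Moore–Penrose) pseudoinversion.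
   Context: $S^+(p,n)$ is the set of real symmetric positive semidefinite $n\times n$ matrices of rank $p$; $V_{n,p}=\{U\in\mathbb R^{n\times p}:U^TU=I_p\}$; $P_p$ is the set of symmetric positive definite $p\times p$ matrices. Given $A,B\in S^+(p,n)$, let $V_A,V_B\in V_{n,p}$ have column spaces $\mathrm{range}(A),\mathrm{range}(B)$, and let $O_A,O_B\in O(p)$ come from a singular value decomposition $O_A^TV_A^TV_BO_B=\mathrm{diag}(\sigma_1,\dots,\sigma_p)$, $1\ge\sigma_1\ge\dots\ge\sigma_p\ge0$, $\sigma_i=\cos\theta_i$ with principal angles $0\le\theta_1\le\dots\le\theta_p\le\pi/2$. Put $U_A=V_AO_A$, $U_B=V_BO_B$, $\Theta=\mathrm{diag}(\theta_1,\dots,\theta_p)$, $X=(I-U_AU_A^T)U_BF$ with $F$ the pseudoinverse of $\mathrm{diag}(\sin\theta_1,\dots,\sin\theta_p)$, and $R_A,R_B\in P_p$ with $R_A^2=U_A^TAU_A$, $R_B^2=U_B^TBU_B$. The (geometric) mean of $A$ and $B$ is $$A\circ B=WKW^T,\qquad K=R_A(R_A^{-1}R_B^2R_A^{-1})^{1/2}R_A,\qquad W=U_A\cos(\Theta/2)+X\sin(\Theta/2).$$ Throughout it is assumed that $\theta_p\ne\pi/2$, in which case $A\circ B$ is uniquely defined. *)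

theory Defs
  imports "HOL-Analysis.Analysis"
begin

definition psd :: "real^'n^'n \<Rightarrow> bool" where
  "psd M \<longleftrightarrow> transpose M = M \<and> (\<forall>x. 0 \<le> x \<bullet> (M *v x))"

definition posdef :: "real^'n^'n \<Rightarrow> bool" where
  "posdef M \<longleftrightarrow> transpose M = M \<and> (\<forall>x. x \<noteq> 0 \<longrightarrow> 0 < x \<bullet> (M *v x))"

definition loewner_le :: "real^'n^'n \<Rightarrow> real^'n^'n \<Rightarrow> bool" where
  "loewner_le M N \<longleftrightarrow> psd (N - M)"

definition spsd_of_rank :: "nat \<Rightarrow> (real^'n^'n) set" where
  "spsd_of_rank p = {M. psd M \<and> rank M = p}"

definition stiefel :: "(real^'p^'n) set" where
  "stiefel = {U. transpose U ** U = mat 1}"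

definition diag :: "real^'p \<Rightarrow> real^'p^'p" where
  "diag v = (\<chi> i j. if i = j then v $ i else 0)"

definition psd_sqrt :: "real^'n^'n \<Rightarrow> real^'n^'n" where
  "psd_sqrt M = (THE S. psd S \<and> S ** S = M)"

text \<open>The four Penrose conditions.\<close>

definition is_pseudoinverse :: "real^'n^'m \<Rightarrow> real^'m^'n \<Rightarrow> bool" where
  "is_pseudoinverse A X \<longleftrightarrow>
     A ** X ** A = A \<and> X ** A ** X = X \<and>
     transpose (A ** X) = A ** X \<and> transpose (X ** A) = X ** A"

definition pseudoinverse :: "real^'n^'m \<Rightarrow> real^'m^'n" where
  "pseudoinverse A = (THE X. is_pseudoinverse A X)"

text \<open>
  The number p is represented as the cardinality of a finite linearly ordered type, whose
  elements play the role of the indices 1, ..., p; the order expresses that the principal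
  angles are listed increasingly. The predicate says that \<open>UA = VA OA\<close>, \<open>UB = VB OB\<close> and \<open>\<theta>\<close>
  arise from some choice of orthonormal bases \<open>VA\<close>, \<open>VB\<close> of the two ranges and some singular
  value decomposition of \<open>VA\<^sup>T VB\<close>, with singular values \<open>cos \<theta>\<close>.
\<close>

definition principal_frames ::
  "real^'n^'n \<Rightarrow> real^'n^'n \<Rightarrow> real^('p::{finite,linorder})^'n \<Rightarrow> real^('p::{finite,linorder})^'n
     \<Rightarrow> real^('p::{finite,linorder}) \<Rightarrow> bool"
where
  "principal_frames A B UA UB \<theta> \<longleftrightarrow>
     (\<forall>i. 0 \<le> \<theta> $ i \<and> \<theta> $ i \<le> pi / 2) \<and>
     (\<forall>i j. i \<le> j \<longrightarrow> \<theta> $ i \<le> \<theta> $ j) \<and>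
     (\<exists>VA VB OA OB.
        VA \<in> stiefel \<and> span (columns VA) = range (\<lambda>x. A *v x) \<and>
        VB \<in> stiefel \<and> span (columns VB) = range (\<lambda>x. B *v x) \<and>
        orthogonal_matrix OA \<and> orthogonal_matrix OB \<and>
        transpose OA ** transpose VA ** VB ** OB = diag (\<chi> i. cos (\<theta> $ i)) \<and>
        UA = VA ** OA \<and> UB = VB ** OB)"

definition principal_angles ::
  "real^'n^'n \<Rightarrow> real^'n^'n \<Rightarrow> real^('p::{finite,linorder})" where
  "principal_angles A B = (THE \<theta>. \<exists>UA UB. principal_frames A B UA UB \<theta>)"

text \<open>
  The type argument supplies p, which cannot be read off from the types of the n-by-n
  matrices.
\<close>

definition largest_principal_angle ::
  "'p::{finite,linorder} itself \<Rightarrow> real^'n^'n \<Rightarrow> real^'n^'n \<Rightarrow> real" where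
  "largest_principal_angle p A B = (principal_angles A B :: real^('p::{finite,linorder})) $ Max UNIV"

definition is_geometric_mean ::
  "'p::{finite,linorder} itself \<Rightarrow> real^'n^'n \<Rightarrow> real^'n^'n \<Rightarrow> real^'n^'n \<Rightarrow> bool" where
  "is_geometric_mean p A B M \<longleftrightarrow>
     (\<exists>(UA :: real^('p::{finite,linorder})^'n) UB \<theta> RA RB.
        principal_frames A B UA UB \<theta> \<and>
        posdef RA \<and> RA ** RA = transpose UA ** A ** UA \<and>
        posdef RB \<and> RB ** RB = transpose UB ** B ** UB \<and>
        (let F = pseudoinverse (diag (\<chi> i. sin (\<theta> $ i)));
             X = (mat 1 - UA ** transpose UA) ** UB ** F;
             W = UA ** diag (\<chi> i. cos (\<theta> $ i / 2)) + X ** diag (\<chi> i. sin (\<theta> $ i / 2));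
             K = RA ** psd_sqrt (matrix_inv RA ** (RB ** RB) ** matrix_inv RA) ** RA
         in M = W ** K ** transpose W))"

text \<open>
  The matrix described by \<open>is_geometric_mean\<close> does not depend on the choices of frames as long
  as the largest principal angle differs from \<open>pi / 2\<close>.
\<close>

definition geometric_mean ::
  "'p::{finite,linorder} itself \<Rightarrow> real^'n^'n \<Rightarrow> real^'n^'n \<Rightarrow> real^'n^'n" where
  "geometric_mean p A B = (THE M. is_geometric_mean p A B M)"

end

theory Submission
  imports Defs
begin

text \<open>
  The mean \<open>W K W\<^sup>T\<close> separates into a midpoint \<open>W\<close> of the two ranges and a mean \<open>K\<close> of two positive
  definite \<open>p \<times> p\<close> matrices. Each of the five properties reduces to a property of one of the factors as
  soon as both are described without their defining formulas.

  The columns of \<open>W\<close> are the normalized bisectors of the pairs of principal vectors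
  (\<open>geodesic_midpoint_eq_midpoint_frame\<close>), so \<open>W = (UA + UB) E\<close> for a diagonal matrix \<open>E\<close> depending only
  on the angles. This is symmetric in the two frames, has orthonormal columns, depends on \<open>A\<close> and \<open>B\<close>
  only through their ranges, and moves along with the ranges under orthogonal maps.

  The matrix \<open>K\<close> is the only positive definite solution of the Riccati equation \<open>X G\<^sup>-\<^sup>1 X = H\<close>, where \<open>G\<close>
  and \<open>H\<close> are the compressions of \<open>A\<close> and \<open>B\<close> to their ranges. Homogeneity, symmetry, behaviour under
  orthogonal congruence and under inversion follow by inserting the candidate into the equation;
  uniqueness and monotonicity follow from the operator monotonicity of the square root
  (\<open>psd_square_root_monotone\<close>, \<open>riccati_monotone\<close>).

  The mean and the principal angles are given by definite descriptions, so existence and uniqueness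
  carry much of the weight. Existence rests on the spectral theorem and the singular value
  decomposition. The angles are unique because ordered singular values are; hence the hypothesis on the
  largest principal angle says that every angle of every pair of principal frames is acute. In that
  case two pairs of principal frames differ by one common orthogonal matrix that commutes with all
  functions of the angles, and it cancels in \<open>W K W\<^sup>T\<close> (\<open>mean_in_frames_independent\<close>).

  For monotonicity one observes in addition that \<open>A \<le> A\<^sub>0\<close> with equal ranks forces equal ranges, so that
  both means are computed in the same frames. For self-duality, pseudoinversion keeps the ranges and
  inverts the compressions.
\<close>

text \<open>
  The default simplification of \<open>transpose A *v x\<close> to a row vector product is switched off, because
  adjoints are moved across inner products throughout.
\<close>

declare transpose_matrix_vector [simp del] vector_transpose_matrix [simp del]

section \<open>Matrix algebra\<close>

lemma inner_matrix_vector_transpose: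
  fixes M :: "real^'n^'m"
  shows "x \<bullet> (M *v y) = (transpose M *v x) \<bullet> y"
  by (simp add: transpose_matrix_vector dot_lmul_matrix)

lemma symmetric_inner_commute:
  fixes M :: "real^'n^'n"
  assumes "transpose M = M"
  shows "x \<bullet> (M *v y) = y \<bullet> (M *v x)"
  by (metis assms inner_commute inner_matrix_vector_transpose)

lemma inner_square:
  fixes M :: "real^'n^'n"
  assumes "transpose M = M"
  shows "x \<bullet> ((M ** M) *v x) = (M *v x) \<bullet> (M *v x)"
  by (metis assms inner_matrix_vector_transpose matrix_vector_mul_assoc)

lemma inner_congruence:
  fixes M :: "real^'n^'n" and C :: "real^'m^'n"
  shows "x \<bullet> ((transpose C ** M ** C) *v x) = (C *v x) \<bullet> (M *v (C *v x))"
  by (metis inner_matrix_vector_transpose matrix_vector_mul_assoc transpose_transpose)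

lemma matrix_mul_scaleR [simp]:
  fixes A :: "real^'n^'m"
  shows "(k *\<^sub>R A) ** B = k *\<^sub>R (A ** B)" "A ** (k *\<^sub>R B) = k *\<^sub>R (A ** B)"
  by (simp_all add: scalar_matrix_assoc matrix_scalar_ac)

lemma matrix_mul_diff_distrib:
  fixes A :: "real^'n^'m"
  shows "A ** (B - C) = A ** B - A ** C" "(B' - C') ** A = B' ** A - C' ** A"
  by (simp_all add: vec_eq_iff matrix_matrix_mult_def algebra_simps sum_subtractf)

lemma matrix_mul_add_distrib:
  fixes A :: "real^'n^'m"
  shows "A ** (B + C) = A ** B + A ** C" "(B' + C') ** A = B' ** A + C' ** A"
  by (simp_all add: vec_eq_iff matrix_matrix_mult_def algebra_simps sum.distrib)

lemma transpose_add_diff: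
  fixes A B :: "real^'n^'m"
  shows "transpose (A + B) = transpose A + transpose B"
    and "transpose (A - B) = transpose A - transpose B"
  by (simp_all add: vec_eq_iff transpose_def)

lemma matrix_mul_cancel_right:
  fixes P :: "real^'n^'m" and Q :: "real^'l^'n" and Y :: "real^'m^'k"
  assumes "P ** Q = R"
  shows "Y ** P ** Q = Y ** R"
  using assms by (simp add: matrix_mul_assoc[symmetric])

lemma matrix_inv_unique:
  fixes A :: "real^'n^'n"
  assumes "A ** B = mat 1"
  shows "matrix_inv A = B"
proof -
  have BA: "B ** A = mat 1"
    using assms matrix_left_right_inverse by blast
  have "A ** matrix_inv A = mat 1 \<and> matrix_inv A ** A = mat 1"
    unfolding matrix_inv_def by (rule someI[of _ B]) (simp add: assms BA)
  then have "matrix_inv A = B ** A ** matrix_inv A"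
    by (simp add: BA)
  also have "\<dots> = B"
    using \<open>A ** matrix_inv A = mat 1 \<and> _\<close> by (simp add: matrix_mul_assoc[symmetric])
  finally show ?thesis .
qed

lemma diag_nth: "diag v $ i $ j = (if i = j then v $ i else 0)"
  by (simp add: diag_def)

lemma transpose_diag [simp]: "transpose (diag v) = diag v"
  by (simp add: vec_eq_iff transpose_def diag_nth)

lemma diag_vector_nth: "(diag v *v x) $ i = v $ i * x $ i"
  by (simp add: matrix_vector_mult_def diag_nth if_distrib if_distribR cong: if_cong)

lemma diag_mul_nth: "(diag v ** A) $ i $ j = v $ i * A $ i $ j"
  by (simp add: matrix_matrix_mult_def diag_nth if_distrib if_distribR cong: if_cong)

lemma mul_diag_nth: "(A ** diag v) $ i $ j = A $ i $ j * v $ j"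
  by (simp add: matrix_matrix_mult_def diag_nth if_distrib if_distribR cong: if_cong)

lemma diag_mul_diag: "diag v ** diag w = diag (\<chi> i. v $ i * w $ i)"
  by (simp add: vec_eq_iff diag_mul_nth) (simp add: diag_nth)

lemma norm_orthogonal_matrix_vector:
  fixes Q :: "real^'n^'m"
  assumes "transpose Q ** Q = mat 1"
  shows "norm (Q *v x) = norm x"
proof -
  have "(Q *v x) \<bullet> (Q *v x) = x \<bullet> x"
    by (metis assms inner_matrix_vector_transpose matrix_vector_mul_assoc matrix_vector_mul_lid
        transpose_transpose)
  then show ?thesis by (simp add: norm_eq_sqrt_inner)
qed

section \<open>Semidefinite forms and the spectral theorem\<close>

lemma psd_symmetric: "psd M \<Longrightarrow> transpose M = M"
  by (simp add: psd_def)

lemma posdef_symmetric: "posdef M \<Longrightarrow> transpose M = M"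
  by (simp add: posdef_def)

lemma posdef_imp_psd: "posdef M \<Longrightarrow> psd M"
  unfolding posdef_def psd_def by (metis inner_zero_left less_eq_real_def)

text \<open>
  The weak Cauchy--Schwarz statement for forms that are nonnegative on a subspace: along the line
  through \<open>v\<close> in direction \<open>y\<close> the form is a nonnegative quadratic polynomial that vanishes at \<open>v\<close>, so
  its derivative there vanishes too. On the whole space this identifies the isotropic vectors of a
  semidefinite matrix with its kernel; on a proper subspace it shows that minimizers of the Rayleigh
  quotient are eigenvectors.
\<close>

lemma isotropic_vector_in_kernel_of_form:
  fixes M :: "real^'n^'n"
  assumes sym: "transpose M = M" and S: "subspace S"
    and nonneg: "\<And>x. x \<in> S \<Longrightarrow> 0 \<le> x \<bullet> (M *v x)"
    and v: "v \<in> S" "v \<bullet> (M *v v) = 0" and y: "y \<in> S"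
  shows "y \<bullet> (M *v v) = 0"
proof (rule ccontr)
  assume ne: "y \<bullet> (M *v v) \<noteq> 0"
  define a where "a = y \<bullet> (M *v v)"
  define b where "b = y \<bullet> (M *v y)"
  have b: "b \<ge> 0" using nonneg y by (simp add: b_def)
  have expand: "0 \<le> 2 * t * a + t^2 * b" for t :: real
  proof -
    have "v + t *\<^sub>R y \<in> S" using S v y by (simp add: subspace_add subspace_scale)
    then have "0 \<le> (v + t *\<^sub>R y) \<bullet> (M *v (v + t *\<^sub>R y))" by (rule nonneg)
    also have "\<dots> = 2 * t * a + t^2 * b"
      using v(2) symmetric_inner_commute[OF sym, of v y]
      by (simp add: algebra_simps inner_add_left inner_add_right matrix_vector_right_distrib
          matrix_vector_mult_scaleR a_def b_def power2_eq_square)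
    finally show ?thesis .
  qed
  \<comment> \<open>The quadratic in \<open>t\<close> vanishes at \<open>0\<close> with slope \<open>2 a\<close>; a small \<open>t\<close> of sign opposite to \<open>a\<close> makes
      it negative.\<close>
  have "0 \<le> 2 * (- a / (b + 1)) * a + (- a / (b + 1))^2 * b" by (rule expand)
  also have "\<dots> = - (a^2 * (b + 2) / (b + 1)^2)"
  proof -
    have "b + 1 \<noteq> 0" using b by linarith
    then show ?thesis by (simp add: divide_simps power2_eq_square) algebra
  qed
  also have "\<dots> < 0" using b ne by (simp add: a_def)
  finally show False by simp
qed

lemma psd_isotropic_vector:
  assumes "psd M" "x \<bullet> (M *v x) = 0"
  shows "M *v x = 0"
  using isotropic_vector_in_kernel_of_form[of M UNIV x "M *v x"] assms
  by (simp add: psd_def)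

text \<open>
  The Rayleigh quotient attains its minimum \<open>l\<close> on the compact unit sphere of \<open>S\<close>. There \<open>M - l I\<close> is
  nonnegative on \<open>S\<close> and vanishes at the minimizer \<open>v\<close>, so \<open>M v - l v\<close> is orthogonal to \<open>S\<close>; by
  invariance it also lies in \<open>S\<close>. The bound on all of \<open>S\<close> is kept for the monotonicity of square
  roots, where only the smallest eigenvalue counts.
\<close>

lemma minimal_eigenvector_in_invariant_subspace:
  fixes M :: "real^'n^'n"
  assumes sym: "transpose M = M" and S: "subspace S" and ne: "\<exists>x\<in>S. x \<noteq> 0"
    and inv: "\<And>x. x \<in> S \<Longrightarrow> M *v x \<in> S"
  obtains v l where "v \<in> S" "norm v = 1" "M *v v = l *\<^sub>R v"
    "\<And>x. x \<in> S \<Longrightarrow> l * (x \<bullet> x) \<le> x \<bullet> (M *v x)"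
proof -
  let ?q = "\<lambda>x. x \<bullet> (M *v x)"
  let ?K = "S \<inter> sphere 0 1"
  have "compact ?K"
    by (simp add: closed_Int_compact closed_subspace[OF S])
  moreover obtain z where z: "z \<in> S" "z \<noteq> 0" using ne by auto
  then have "(1 / norm z) *\<^sub>R z \<in> ?K" using S by (simp add: subspace_scale)
  then have "?K \<noteq> {}" by blast
  moreover have "continuous_on ?K ?q"
    by (intro continuous_intros linear_continuous_on linear_linear[THEN iffD2] matrix_vector_mul_linear)
  ultimately obtain v where v: "v \<in> ?K" and min: "\<And>x. x \<in> ?K \<Longrightarrow> ?q v \<le> ?q x"
    using continuous_attains_inf[of ?K ?q] by blast
  define l where "l = ?q v"
  have vv: "v \<bullet> v = 1" and vS: "v \<in> S" and nv: "norm v = 1" using v by (auto simp: norm_eq_1)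
  have bound: "l * (x \<bullet> x) \<le> ?q x" if "x \<in> S" for x
  proof (cases "x = 0")
    case False
    have "(1 / norm x) *\<^sub>R x \<in> ?K" using that S False by (simp add: subspace_scale)
    then have "l \<le> ?q ((1 / norm x) *\<^sub>R x)" unfolding l_def by (rule min)
    also have "\<dots> = ?q x / (norm x)^2"
      by (simp add: matrix_vector_mult_scaleR power2_eq_square)
    finally show ?thesis using False
      by (simp add: field_simps dot_square_norm)
  qed auto
  define N where "N = M - l *\<^sub>R mat 1"
  have Nv: "N *v x = M *v x - l *\<^sub>R x" for x
    by (simp add: N_def matrix_vector_mult_diff_rdistrib scaleR_matrix_vector_assoc[symmetric])
  have "M *v v - l *\<^sub>R v \<in> S" using inv vS S by (simp add: subspace_diff subspace_scale)
  then have "(M *v v - l *\<^sub>R v) \<bullet> (N *v v) = 0"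
  proof (rule isotropic_vector_in_kernel_of_form[OF _ S _ vS, rotated -1])
    show "transpose N = N" by (simp add: N_def transpose_add_diff sym transpose_scalar)
    show "0 \<le> x \<bullet> (N *v x)" if "x \<in> S" for x
      using bound[OF that] by (simp add: Nv inner_diff_right)
    show "v \<bullet> (N *v v) = 0" by (simp add: Nv inner_diff_right vv l_def)
  qed
  then have "M *v v = l *\<^sub>R v" by (simp add: Nv)
  then show thesis using that vS nv bound by blast
qed

definition orthonormal_on :: "'i set \<Rightarrow> ('i \<Rightarrow> 'a::real_inner) \<Rightarrow> bool" where
  "orthonormal_on I u \<longleftrightarrow> (\<forall>i\<in>I. \<forall>j\<in>I. u i \<bullet> u j = (if i = j then 1 else 0))"

lemma orthonormal_on_insert:
  assumes "orthonormal_on I u" "j \<notin> I" "norm x = 1" "\<And>i. i \<in> I \<Longrightarrow> u i \<bullet> x = 0"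
  shows "orthonormal_on (insert j I) (u(j := x))"
  using assms unfolding orthonormal_on_def by (auto simp: norm_eq_1 inner_commute)

text \<open>
  Fewer than \<open>n\<close> vectors do not span the space; the missing index \<open>j\<close> is the convenient way to say
  "fewer than \<open>n\<close>" for families indexed by the coordinate type.
\<close>

lemma exists_vector_orthogonal_to_few:
  fixes u :: "'n \<Rightarrow> real^'n"
  assumes "j \<notin> J"
  obtains x where "x \<noteq> 0" "\<And>i. i \<in> J \<Longrightarrow> u i \<bullet> x = 0"
proof -
  have "dim (u ` J) \<le> card (u ` J)" by (rule dim_le_card') simp
  also have "\<dots> \<le> card J" by (rule card_image_le) simp
  also have "\<dots> < CARD('n)" using assms by (intro psubset_card_mono) auto
  finally have "dim (u ` J) < DIM(real^'n)" by simp
  then obtain x where "x \<noteq> 0" "\<And>y. y \<in> span (u ` J) \<Longrightarrow> orthogonal x y"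
    using orthogonal_to_subspace_exists by blast
  then show thesis using that
    by (metis imageI inner_commute orthogonal_def span_base)
qed

text \<open>
  The missing members are added one index at a time, each chosen orthogonal to all earlier ones.
\<close>

lemma extend_orthonormal_family:
  fixes u :: "'n \<Rightarrow> real^'n"
  assumes "orthonormal_on I u"
  obtains w where "orthonormal_on UNIV w" "\<And>i. i \<in> I \<Longrightarrow> w i = u i"
proof -
  have "\<exists>w. orthonormal_on (I \<union> J) w \<and> (\<forall>i\<in>I. w i = u i)" if "finite J" for J
    using that
  proof induction
    case empty
    then show ?case using assms by auto
  next
    case (insert j J)
    then obtain w where w: "orthonormal_on (I \<union> J) w" "\<forall>i\<in>I. w i = u i" by auto
    show ?case
    proof (cases "j \<in> I")
      case True
      then show ?thesis using w by (auto simp: insert_absorb)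
    next
      case False
      then have j: "j \<notin> I \<union> J" using insert by auto
      then obtain x where x: "x \<noteq> 0" "\<And>i. i \<in> I \<union> J \<Longrightarrow> w i \<bullet> x = 0"
        using exists_vector_orthogonal_to_few by metis
      have "orthonormal_on (insert j (I \<union> J)) (w(j := (1 / norm x) *\<^sub>R x))"
        by (rule orthonormal_on_insert[OF w(1) j]) (use x in auto)
      moreover have "\<forall>i\<in>I. (w(j := (1 / norm x) *\<^sub>R x)) i = u i" using w(2) False by auto
      ultimately show ?thesis by (metis Un_insert_right)
    qed
  qed
  from this[OF finite[of UNIV]] show thesis using that by auto
qed

text \<open>
  Eigenvectors are again collected one index at a time: the orthogonal complement of the eigenvectors
  found so far is invariant because the matrix is symmetric, so it contains a further eigenvector.
\<close>

lemma symmetric_orthonormal_eigenbasis: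
  fixes M :: "real^'n^'n"
  assumes sym: "transpose M = M"
  obtains u d where "orthonormal_on UNIV u" "\<And>i::'n. M *v u i = d i *\<^sub>R u i"
proof -
  have "\<exists>u d. orthonormal_on J u \<and> (\<forall>i\<in>J. M *v u i = d i *\<^sub>R u i)" if "finite J" for J :: "'n set"
    using that
  proof induction
    case empty
    then show ?case by (simp add: orthonormal_on_def)
  next
    case (insert j J)
    then obtain u d where u: "orthonormal_on J u" and d: "\<And>i. i \<in> J \<Longrightarrow> M *v u i = d i *\<^sub>R u i"
      by auto
    define S where "S = {x. \<forall>i\<in>J. u i \<bullet> x = 0}"
    have S: "subspace S" unfolding subspace_def S_def by (simp add: inner_add_right)
    have inv: "M *v x \<in> S" if "x \<in> S" for x
    proof -
      have "u i \<bullet> (M *v x) = 0" if "i \<in> J" for i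
        using d[OF that] \<open>x \<in> S\<close> that symmetric_inner_commute[OF sym, of "u i" x]
        by (simp add: S_def inner_commute)
      then show ?thesis by (simp add: S_def)
    qed
    obtain z where "z \<noteq> 0" "\<And>i. i \<in> J \<Longrightarrow> u i \<bullet> z = 0"
      using exists_vector_orthogonal_to_few[OF \<open>j \<notin> J\<close>] by metis
    then have "\<exists>x\<in>S. x \<noteq> 0" by (auto simp: S_def)
    from minimal_eigenvector_in_invariant_subspace[OF sym S this inv]
    obtain v l where v: "v \<in> S" "norm v = 1" "M *v v = l *\<^sub>R v" by blast
    have "orthonormal_on (insert j J) (u(j := v))"
      by (rule orthonormal_on_insert[OF u \<open>j \<notin> J\<close> v(2)]) (use v(1) in \<open>auto simp: S_def\<close>)
    moreover have "\<forall>i\<in>insert j J. M *v (u(j := v)) i = (d(j := l)) i *\<^sub>R (u(j := v)) i"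
      using d v(3) insert by auto
    ultimately show ?case by blast
  qed
  from this[OF finite[of UNIV]] show thesis using that by auto
qed

definition cols :: "('p \<Rightarrow> real^'n) \<Rightarrow> real^'p^'n" where
  "cols u = (\<chi> i j. u j $ i)"

lemma cols_gram: "(transpose (cols u) ** N ** cols v) $ i $ j = u i \<bullet> (N *v v j)"
proof -
  have "(transpose (cols u) ** N ** cols v) $ i $ j = (transpose (cols u) ** N ** cols v) $ i \<bullet> axis j 1"
    by (simp add: inner_axis)
  also have "\<dots> = axis i 1 \<bullet> ((transpose (cols u) ** N ** cols v) *v axis j 1)"
    by (simp add: matrix_vector_mult_basis column_def inner_axis inner_axis')
  also have "\<dots> = (cols u *v axis i 1) \<bullet> (N *v (cols v *v axis j 1))"
    by (metis inner_matrix_vector_transpose matrix_vector_mul_assoc transpose_transpose)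
  also have "\<dots> = u i \<bullet> (N *v v j)"
    by (simp add: matrix_vector_mult_basis column_def cols_def)
  finally show ?thesis .
qed

lemma cols_orthonormal:
  fixes u :: "'p::finite \<Rightarrow> real^'n"
  assumes "orthonormal_on UNIV u"
  shows "transpose (cols u) ** cols u = mat 1"
proof -
  have "transpose (cols u) ** mat 1 ** cols u = mat 1"
    using assms by (simp only: vec_eq_iff cols_gram) (simp add: orthonormal_on_def, simp add: mat_def)
  then show ?thesis by simp
qed

theorem spectral_theorem:
  fixes M :: "real^'n^'n"
  assumes "transpose M = M"
  obtains Q d where "orthogonal_matrix Q" "M = Q ** diag d ** transpose Q"
proof -
  obtain u :: "'n \<Rightarrow> real^'n" and d where u: "orthonormal_on UNIV u" and d: "\<And>i. M *v u i = d i *\<^sub>R u i"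
    using symmetric_orthonormal_eigenbasis[OF assms] by metis
  have Q: "orthogonal_matrix (cols u)"
    using cols_orthonormal[OF u] by (simp add: orthogonal_matrix)
  have "transpose (cols u) ** M ** cols u = diag (\<chi> i. d i)"
    using u by (simp only: vec_eq_iff cols_gram) (simp add: d orthonormal_on_def diag_nth)
  then have "cols u ** diag (\<chi> i. d i) ** transpose (cols u)
      = (cols u ** transpose (cols u)) ** M ** (cols u ** transpose (cols u))"
    by (metis matrix_mul_assoc)
  also have "\<dots> = M" using Q by (simp add: orthogonal_matrix_def)
  finally show thesis using that[OF Q] by metis
qed

lemma psd_square_root_exists:
  assumes "psd M"
  obtains S where "psd S" "S ** S = M"
proof -
  obtain Q d where Q: "orthogonal_matrix Q" and M: "M = Q ** diag d ** transpose Q"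
    using spectral_theorem[OF psd_symmetric[OF assms]] by metis
  have QQ: "transpose Q ** Q = mat 1" using Q by (simp add: orthogonal_matrix)
  have "transpose Q ** M ** Q = diag d"
    by (simp add: M matrix_mul_assoc QQ) (simp add: matrix_mul_assoc[symmetric] QQ)
  then have "d $ i = axis i 1 \<bullet> ((transpose Q ** M ** Q) *v axis i 1)" for i
    by (simp add: inner_axis' diag_vector_nth)
  then have d: "d $ i \<ge> 0" for i
    using assms unfolding inner_congruence psd_def by metis
  define S where "S = Q ** diag (\<chi> i. sqrt (d $ i)) ** transpose Q"
  have "S ** S = Q ** diag (\<chi> i. sqrt (d $ i)) ** (transpose Q ** Q) ** diag (\<chi> i. sqrt (d $ i)) ** transpose Q"
    by (simp add: S_def matrix_mul_assoc)
  also have "\<dots> = Q ** (diag (\<chi> i. sqrt (d $ i)) ** diag (\<chi> i. sqrt (d $ i))) ** transpose Q"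
    by (simp add: QQ matrix_mul_assoc)
  also have "\<dots> = M" using d by (simp add: M diag_mul_diag)
  finally have "S ** S = M" .
  moreover have "0 \<le> x \<bullet> (S *v x)" for x
  proof -
    have "x \<bullet> (S *v x) = (transpose Q *v x) \<bullet> (diag (\<chi> i. sqrt (d $ i)) *v (transpose Q *v x))"
      using inner_congruence[of x "transpose Q" "diag (\<chi> i. sqrt (d $ i))"] by (simp add: S_def)
    also have "\<dots> \<ge> 0"
      unfolding inner_vec_def
      by (intro sum_nonneg) (simp add: diag_vector_nth d mult.left_commute)
    finally show ?thesis .
  qed
  then have "psd S" by (simp add: psd_def S_def matrix_transpose_mul matrix_mul_assoc)
  ultimately show thesis using that by blast
qed

text \<open>
  Operator monotonicity of the square root. Let \<open>v\<close> be a unit eigenvector of \<open>Z - Y\<close> for its smallest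
  eigenvalue \<open>l\<close>. If \<open>l < 0\<close>, then \<open>Y v = Z v + |l| v\<close> is strictly longer than \<open>Z v\<close>, because
  \<open>v \<bullet> Z v \<ge> 0\<close>; this contradicts \<open>Y\<^sup>2 \<le> Z\<^sup>2\<close>. Uniqueness of the square root is the case of equality.
\<close>

lemma psd_square_root_monotone:
  assumes Y: "psd Y" and Z: "psd Z" and le: "loewner_le (Y ** Y) (Z ** Z)"
  shows "loewner_le Y Z"
proof -
  have sym: "transpose (Z - Y) = Z - Y" using Y Z by (simp add: psd_def transpose_add_diff)
  have "\<exists>x\<in>UNIV. x \<noteq> (0::real^'a)" by (intro bexI[of _ 1]) auto
  from minimal_eigenvector_in_invariant_subspace[OF sym subspace_UNIV this]
  obtain v l where v: "norm v = 1" "(Z - Y) *v v = l *\<^sub>R v"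
    and l: "\<And>x. l * (x \<bullet> x) \<le> x \<bullet> ((Z - Y) *v x)"
    by auto
  have vv: "v \<bullet> v = 1" using v(1) by (simp add: norm_eq_1)
  have "l \<ge> 0"
  proof (rule ccontr)
    assume neg: "\<not> l \<ge> 0"
    have Yv: "Y *v v = Z *v v - l *\<^sub>R v" 
      using v(2) unfolding matrix_vector_mult_diff_rdistrib
      by (metis add_diff_cancel_left' diff_add_cancel)
    have "0 \<le> v \<bullet> ((Z ** Z - Y ** Y) *v v)" using le by (simp add: loewner_le_def psd_def)
    also have "\<dots> = (Z *v v) \<bullet> (Z *v v) - (Y *v v) \<bullet> (Y *v v)"
      using Y Z by (simp add: matrix_vector_mult_diff_rdistrib inner_diff_right inner_square psd_def)
    also have "\<dots> = 2 * l * (v \<bullet> (Z *v v)) - l^2"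
      unfolding Yv using vv
      by (simp add: inner_diff_left inner_diff_right power2_eq_square algebra_simps inner_commute)
    also have "\<dots> < 0"
    proof -
      have "0 \<le> v \<bullet> (Z *v v)" using Z by (simp add: psd_def)
      then have "2 * l * (v \<bullet> (Z *v v)) \<le> 0" using neg by (simp add: mult_nonpos_nonneg)
      moreover have "l^2 > 0" using neg by simp
      ultimately show ?thesis by linarith
    qed
    finally show False by simp
  qed
  then have "0 \<le> x \<bullet> ((Z - Y) *v x)" for x
    by (meson inner_ge_zero l mult_nonneg_nonneg order_trans)
  then show ?thesis using sym by (simp add: loewner_le_def psd_def)
qed

lemma loewner_le_antisym:
  assumes "loewner_le M N" "loewner_le N M"
  shows "M = N"
proof -
  have "(N - M) *v x = 0" for x
  proof (rule psd_isotropic_vector)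
    show "psd (N - M)" using assms(1) by (simp add: loewner_le_def)
    have "0 \<le> x \<bullet> ((N - M) *v x)" "0 \<le> x \<bullet> ((M - N) *v x)"
      using assms by (auto simp: loewner_le_def psd_def)
    then show "x \<bullet> ((N - M) *v x) = 0"
      by (simp add: matrix_vector_mult_diff_rdistrib inner_diff_right)
  qed
  then show ?thesis by (simp add: matrix_eq matrix_vector_mult_diff_rdistrib)
qed

lemma loewner_le_refl: "loewner_le M M"
  by (simp add: loewner_le_def psd_def vec_eq_iff transpose_def)

lemma psd_square_root_unique:
  assumes "psd Y" "psd Z" "Y ** Y = Z ** Z"
  shows "Y = Z"
  using assms by (metis loewner_le_antisym loewner_le_refl psd_square_root_monotone)

lemma psd_sqrt_eqI:
  assumes "psd S" "S ** S = M"
  shows "psd_sqrt M = S"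
  unfolding psd_sqrt_def using assms by (intro the_equality) (auto intro: psd_square_root_unique)

section \<open>Singular values and principal frames\<close>

text \<open>
  Take an orthonormal eigenbasis \<open>v\<close> of \<open>N\<^sup>T N\<close>. The images \<open>N v\<^sub>i\<close> are pairwise orthogonal; those that
  are nonzero are normalized, and the resulting orthonormal family is completed arbitrarily at the
  indices with \<open>N v\<^sub>i = 0\<close>.
\<close>

theorem singular_value_decomposition:
  fixes N :: "real^'n^'n"
  obtains u v :: "'n \<Rightarrow> real^'n" and s where
    "orthonormal_on UNIV u" "orthonormal_on UNIV v" "\<And>i. 0 \<le> s i"
    "\<And>i j. u i \<bullet> (N *v v j) = (if i = j then s i else 0)"
proof -
  have "transpose (transpose N ** N) = transpose N ** N" by (simp add: matrix_transpose_mul)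
  then obtain v :: "'n \<Rightarrow> real^'n" and d where v: "orthonormal_on UNIV v"
    and d: "\<And>i. (transpose N ** N) *v v i = d i *\<^sub>R v i"
    using symmetric_orthonormal_eigenbasis by metis
  define s where "s i = norm (N *v v i)" for i
  have orth: "(N *v v i) \<bullet> (N *v v j) = 0" if "i \<noteq> j" for i j
  proof -
    have "(N *v v i) \<bullet> (N *v v j) = v i \<bullet> ((transpose N ** N) *v v j)"
      by (metis inner_matrix_vector_transpose matrix_vector_mul_assoc transpose_transpose)
    then show ?thesis using v that by (simp add: d orthonormal_on_def)
  qed
  define I where "I = {i. N *v v i \<noteq> 0}"
  have "orthonormal_on I (\<lambda>i. (1 / s i) *\<^sub>R (N *v v i))"
    unfolding orthonormal_on_def I_def s_def
    by (simp add: orth dot_square_norm power2_eq_square)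
  from extend_orthonormal_family[OF this] obtain u where u: "orthonormal_on UNIV u"
    and uI: "\<And>i. i \<in> I \<Longrightarrow> u i = (1 / s i) *\<^sub>R (N *v v i)"
    by blast
  have Nv: "N *v v j = s j *\<^sub>R u j" for j
    by (cases "j \<in> I") (auto simp: uI I_def s_def)
  show thesis
  proof (rule that[of u v s])
    show "u i \<bullet> (N *v v j) = (if i = j then s i else 0)" for i j
      using u by (simp add: Nv orthonormal_on_def)
  qed (simp_all add: u v s_def)
qed

lemma exists_sorting_bijection:
  fixes f :: "'p::{finite,linorder} \<Rightarrow> 'b::linorder"
  obtains \<pi> :: "'p \<Rightarrow> 'p" where "bij \<pi>" "\<And>i j. i \<le> j \<Longrightarrow> f (\<pi> i) \<le> f (\<pi> j)"
proof -
  define xs where "xs = sorted_list_of_set (UNIV :: 'p set)"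
  define ys where "ys = sort_key f xs"
  have xs: "distinct xs" "set xs = UNIV" "sorted xs" by (auto simp: xs_def)
  have ys: "distinct ys" "set ys = UNIV" "sorted (map f ys)" "length ys = length xs"
    by (auto simp: ys_def xs)
  define idx where "idx = the_inv_into {..<length xs} ((!) xs)"
  have bx: "bij_betw ((!) xs) {..<length xs} UNIV" using xs by (intro bij_betw_nth) auto
  have bi: "bij_betw idx UNIV {..<length xs}" unfolding idx_def by (rule bij_betw_the_inv_into[OF bx])
  have bys: "bij_betw ((!) ys) {..<length xs} UNIV" using ys by (intro bij_betw_nth) auto
  have lt: "idx i < length xs" for i using bi by (auto simp: bij_betw_def)
  have nth: "xs ! idx i = i" for i
    using bx by (simp add: idx_def f_the_inv_into_f_bij_betw)
  have mono: "idx i \<le> idx j" if "i \<le> j" for i j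
  proof (rule ccontr)
    assume "\<not> idx i \<le> idx j"
    then have "xs ! idx j \<le> xs ! idx i" using lt by (intro sorted_nth_mono[OF xs(3)]) auto
    then show False using that \<open>\<not> _\<close> by (simp add: nth)
  qed
  show thesis
  proof (rule that[of "(!) ys \<circ> idx"])
    show "bij ((!) ys \<circ> idx)" using bij_betw_trans[OF bi bys] .
    show "f (((!) ys \<circ> idx) i) \<le> f (((!) ys \<circ> idx) j)" if "i \<le> j" for i j
      using sorted_nth_mono[OF ys(3) mono[OF that]] lt[of i] lt[of j] ys(4) by simp
  qed
qed

text \<open>
  The Courant--Fischer argument. If \<open>c\<^sub>k < d\<^sub>k\<close>, choose \<open>x \<noteq> 0\<close> such that \<open>x\<close> has no coordinates above
  \<open>k\<close> and \<open>Q' x\<close> has none below \<open>k\<close>; these are \<open>p - 1\<close> linear conditions. Then \<open>diag d\<close> stretches \<open>x\<close>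
  by at least \<open>d\<^sub>k\<close>, whereas \<open>diag c\<close> stretches \<open>Q' x\<close>, which has the same length, by at most \<open>c\<^sub>k\<close>.
\<close>

lemma ordered_singular_values_le:
  fixes c d :: "real^('p::{finite,linorder})"
  assumes c: "\<And>i. 0 \<le> c $ i" "\<And>i j. i \<le> j \<Longrightarrow> c $ j \<le> c $ i"
    and d: "\<And>i. 0 \<le> d $ i" "\<And>i j. i \<le> j \<Longrightarrow> d $ j \<le> d $ i"
    and Q: "orthogonal_matrix Q" "orthogonal_matrix Q'"
    and eq: "diag d = transpose Q ** diag c ** Q'"
  shows "d $ k \<le> c $ k"
proof (rule ccontr)
  assume "\<not> d $ k \<le> c $ k"
  then have lt: "c $ k < d $ k" by simp
  \<comment> \<open>Row \<open>i\<close> of \<open>Q'\<close> tests coordinate \<open>i\<close> of \<open>Q' x\<close>, the axis vector tests coordinate \<open>i\<close> of \<open>x\<close>.\<close>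
  obtain x where x: "x \<noteq> 0"
    and orth: "\<And>i. i \<in> UNIV - {k} \<Longrightarrow> (if i < k then Q' $ i else axis i 1) \<bullet> x = 0"
    using exists_vector_orthogonal_to_few[of k "UNIV - {k}" "\<lambda>i. if i < k then Q' $ i else axis i 1"]
    by auto
  define y where "y = Q' *v x"
  have y0: "y $ i = 0" if "i < k" for i
    using orth[of i] that by (simp add: y_def matrix_vector_mul_component)
  have x0: "x $ i = 0" if "k < i" for i
  proof -
    have "i \<noteq> k" "\<not> i < k" using that by auto
    then show ?thesis using orth[of i] by (simp add: inner_axis')
  qed
  have "norm (diag d *v x) = norm (transpose Q *v (diag c *v y))"
    by (simp add: eq y_def matrix_vector_mul_assoc matrix_mul_assoc)
  also have "\<dots> = norm (diag c *v y)"
    using Q(1) by (intro norm_orthogonal_matrix_vector) (simp add: orthogonal_matrix_def)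
  finally have "(diag d *v x) \<bullet> (diag d *v x) = (diag c *v y) \<bullet> (diag c *v y)"
    by (simp add: norm_eq)
  moreover have "(diag c *v y) \<bullet> (diag c *v y) \<le> (c $ k)^2 * (y \<bullet> y)"
    unfolding inner_vec_def sum_distrib_left
  proof (intro sum_mono)
    fix i
    show "(diag c *v y) $ i \<bullet> (diag c *v y) $ i \<le> (c $ k)^2 * (y $ i \<bullet> y $ i)"
    proof (cases "i < k")
      case False
      then have "(c $ i)^2 \<le> (c $ k)^2" using c by (intro power_mono) auto
      then have "(c $ i)^2 * (y $ i)^2 \<le> (c $ k)^2 * (y $ i)^2" by (rule mult_right_mono) simp
      then show ?thesis by (simp add: diag_vector_nth power2_eq_square mult_ac)
    qed (simp add: diag_vector_nth y0)
  qed
  moreover have "(d $ k)^2 * (x \<bullet> x) \<le> (diag d *v x) \<bullet> (diag d *v x)"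
    unfolding inner_vec_def sum_distrib_left
  proof (intro sum_mono)
    fix i
    show "(d $ k)^2 * (x $ i \<bullet> x $ i) \<le> (diag d *v x) $ i \<bullet> (diag d *v x) $ i"
    proof (cases "k < i")
      case False
      then have "(d $ k)^2 \<le> (d $ i)^2" using d by (intro power_mono) auto
      then have "(d $ k)^2 * (x $ i)^2 \<le> (d $ i)^2 * (x $ i)^2" by (rule mult_right_mono) simp
      then show ?thesis by (simp add: diag_vector_nth power2_eq_square mult_ac)
    qed (simp add: x0)
  qed
  moreover have "y \<bullet> y = x \<bullet> x"
    using norm_orthogonal_matrix_vector[of Q' x] Q(2) by (simp add: y_def orthogonal_matrix norm_eq)
  moreover have "(c $ k)^2 * (x \<bullet> x) < (d $ k)^2 * (x \<bullet> x)"
    using x lt c(1)[of k] by (intro mult_strict_right_mono power_strict_mono) auto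
  ultimately show False by simp
qed

lemma ordered_singular_values_unique:
  fixes c d :: "real^('p::{finite,linorder})"
  assumes c: "\<And>i. 0 \<le> c $ i" "\<And>i j. i \<le> j \<Longrightarrow> c $ j \<le> c $ i"
    and d: "\<And>i. 0 \<le> d $ i" "\<And>i j. i \<le> j \<Longrightarrow> d $ j \<le> d $ i"
    and Q: "orthogonal_matrix Q" "orthogonal_matrix Q'"
    and eq: "diag d = transpose Q ** diag c ** Q'"
  shows "d = c"
proof -
  have "transpose (transpose Q) ** diag d ** transpose Q'
      = (Q ** transpose Q) ** diag c ** (Q' ** transpose Q')"
    by (simp add: eq matrix_mul_assoc)
  also have "\<dots> = diag c" using Q by (simp add: orthogonal_matrix_def)
  finally have "diag c = transpose (transpose Q) ** diag d ** transpose Q'" by simp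
  then have "c $ k \<le> d $ k" for k
    by (intro ordered_singular_values_le[OF d c, of "transpose Q" "transpose Q'"]) (use Q in auto)
  moreover have "d $ k \<le> c $ k" for k
    by (rule ordered_singular_values_le[OF c d Q eq])
  ultimately show ?thesis by (simp add: vec_eq_iff antisym)
qed

lemma span_columns_eq_range:
  fixes U :: "real^'p^'n"
  shows "span (columns U) = range (\<lambda>x. U *v x)"
proof
  have "columns U \<subseteq> range (\<lambda>x. U *v x)" by (auto simp: columns_image_basis)
  moreover have "subspace (range (\<lambda>x. U *v x))"
    by (intro linear_subspace_image matrix_vector_mul_linear subspace_UNIV)
  ultimately show "span (columns U) \<subseteq> range (\<lambda>x. U *v x)" by (rule span_minimal)
  show "range (\<lambda>x. U *v x) \<subseteq> span (columns U)" using matrix_vector_mult_in_columnspace by blast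
qed

lemma range_mul_right_surj:
  fixes U :: "real^'p^'n" and Q :: "real^'q^'p" and Q' :: "real^'p^'q"
  assumes "Q ** Q' = mat 1"
  shows "range (\<lambda>x. (U ** Q) *v x) = range (\<lambda>x. U *v x)"
proof -
  have "U *v x = (U ** Q) *v (Q' *v x)" for x
    by (simp add: matrix_vector_mul_assoc matrix_mul_cancel_right[OF assms])
  then show ?thesis by (auto simp flip: matrix_vector_mul_assoc)
qed

lemma rotated_frame:
  fixes V :: "real^'p^'n" and C :: "real^'n^'n"
  assumes "V \<in> stiefel" "span (columns V) = range (\<lambda>x. C *v x)" "orthogonal_matrix Q"
  shows "transpose (V ** Q) ** (V ** Q) = mat 1"
    and "range (\<lambda>x. (V ** Q) *v x) = range (\<lambda>x. C *v x)"
proof -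
  have "transpose (V ** Q) ** (V ** Q) = transpose Q ** (transpose V ** V) ** Q"
    by (simp add: matrix_transpose_mul matrix_mul_assoc)
  then show "transpose (V ** Q) ** (V ** Q) = mat 1"
    using assms by (simp add: stiefel_def orthogonal_matrix)
  show "range (\<lambda>x. (V ** Q) *v x) = range (\<lambda>x. C *v x)"
    using assms range_mul_right_surj[of Q "transpose Q" V]
    by (simp add: orthogonal_matrix_def span_columns_eq_range)
qed

lemma principal_framesI:
  assumes "\<forall>i. 0 \<le> \<theta> $ i \<and> \<theta> $ i \<le> pi / 2" "\<forall>i j. i \<le> j \<longrightarrow> \<theta> $ i \<le> \<theta> $ j"
    and "transpose VA ** VA = mat 1" "range (\<lambda>x. VA *v x) = range (\<lambda>x. A *v x)"
    and "transpose VB ** VB = mat 1" "range (\<lambda>x. VB *v x) = range (\<lambda>x. B *v x)"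
    and "orthogonal_matrix OA" "orthogonal_matrix OB"
    and "transpose OA ** (transpose VA ** VB) ** OB = diag (\<chi> i. cos (\<theta> $ i))"
  shows "principal_frames A B (VA ** OA) (VB ** OB) \<theta>"
proof -
  have *: "VA \<in> stiefel" "VB \<in> stiefel"
    "span (columns VA) = range (\<lambda>x. A *v x)" "span (columns VB) = range (\<lambda>x. B *v x)"
    "transpose OA ** transpose VA ** VB ** OB = diag (\<chi> i. cos (\<theta> $ i))"
    using assms by (simp_all only: stiefel_def mem_Collect_eq span_columns_eq_range matrix_mul_assoc)
  show ?thesis
    unfolding principal_frames_def
    by (rule conjI, fact assms(1), rule conjI, fact assms(2),
        rule exI[of _ VA], rule exI[of _ VB], rule exI[of _ OA], rule exI[of _ OB])
      (intro conjI refl *; fact assms)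
qed

text \<open>
  The bases and the singular value decomposition can be absorbed into the frames \<open>UA\<close> and \<open>UB\<close>, which
  are principal exactly if they are orthonormal bases of the ranges with diagonal cross Gram matrix.
  In this form it is visible that only the ranges of \<open>A\<close> and \<open>B\<close> matter.
\<close>

lemma principal_frames_iff:
  "principal_frames A B UA UB \<theta> \<longleftrightarrow>
     (\<forall>i. 0 \<le> \<theta> $ i \<and> \<theta> $ i \<le> pi / 2) \<and>
     (\<forall>i j. i \<le> j \<longrightarrow> \<theta> $ i \<le> \<theta> $ j) \<and>
     transpose UA ** UA = mat 1 \<and> range (\<lambda>x. UA *v x) = range (\<lambda>x. A *v x) \<and>
     transpose UB ** UB = mat 1 \<and> range (\<lambda>x. UB *v x) = range (\<lambda>x. B *v x) \<and>
     transpose UA ** UB = diag (\<chi> i. cos (\<theta> $ i))"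
proof
  assume "principal_frames A B UA UB \<theta>"
  then obtain VA VB OA OB where
    V: "VA \<in> stiefel" "span (columns VA) = range (\<lambda>x. A *v x)"
       "VB \<in> stiefel" "span (columns VB) = range (\<lambda>x. B *v x)"
       "orthogonal_matrix OA" "orthogonal_matrix OB"
       "UA = VA ** OA" "UB = VB ** OB"
       "transpose OA ** transpose VA ** VB ** OB = diag (\<chi> i. cos (\<theta> $ i))"
    and \<theta>: "\<forall>i. 0 \<le> \<theta> $ i \<and> \<theta> $ i \<le> pi / 2" "\<forall>i j. i \<le> j \<longrightarrow> \<theta> $ i \<le> \<theta> $ j"
    unfolding principal_frames_def by blast
  then show "(\<forall>i. 0 \<le> \<theta> $ i \<and> \<theta> $ i \<le> pi / 2) \<and>
   (\<forall>i j. i \<le> j \<longrightarrow> \<theta> $ i \<le> \<theta> $ j) \<and>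
   transpose UA ** UA = mat 1 \<and> range (\<lambda>x. UA *v x) = range (\<lambda>x. A *v x) \<and>
   transpose UB ** UB = mat 1 \<and> range (\<lambda>x. UB *v x) = range (\<lambda>x. B *v x) \<and>
   transpose UA ** UB = diag (\<chi> i. cos (\<theta> $ i))"
    using rotated_frame[OF V(1,2,5)] rotated_frame[OF V(3,4,6)]
    by (simp add: matrix_transpose_mul matrix_mul_assoc)
next
  assume "(\<forall>i. 0 \<le> \<theta> $ i \<and> \<theta> $ i \<le> pi / 2) \<and>
   (\<forall>i j. i \<le> j \<longrightarrow> \<theta> $ i \<le> \<theta> $ j) \<and>
   transpose UA ** UA = mat 1 \<and> range (\<lambda>x. UA *v x) = range (\<lambda>x. A *v x) \<and>
   transpose UB ** UB = mat 1 \<and> range (\<lambda>x. UB *v x) = range (\<lambda>x. B *v x) \<and>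
   transpose UA ** UB = diag (\<chi> i. cos (\<theta> $ i))"
  then show "principal_frames A B UA UB \<theta>"
    using principal_framesI[of \<theta> UA A UB B "mat 1" "mat 1"] by (simp add: orthogonal_matrix_id)
qed

lemma exists_orthonormal_frame:
  fixes A :: "real^'n^'n"
  assumes "rank A = CARD('p::finite)"
  obtains V :: "real^'p^'n" where "transpose V ** V = mat 1" "range (\<lambda>x. V *v x) = range (\<lambda>x. A *v x)"
proof -
  have "subspace (range (\<lambda>x. A *v x))"
    by (intro linear_subspace_image matrix_vector_mul_linear subspace_UNIV)
  then obtain B where B: "pairwise orthogonal B" "\<And>x. x \<in> B \<Longrightarrow> norm x = 1"
    "independent B" "card B = dim (range (\<lambda>x. A *v x))" "span B = range (\<lambda>x. A *v x)"
    using orthonormal_basis_subspace by metis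
  have "finite B" using B(3) by (rule independent_imp_finite)
  moreover have "card B = CARD('p)" using B(4) assms by (simp add: rank_dim_range)
  ultimately obtain u :: "'p \<Rightarrow> real^'n" where u: "bij_betw u UNIV B"
    by (metis finite finite_same_card_bij)
  have uB: "u i \<in> B" for i using u by (auto simp: bij_betw_def)
  have "u i \<bullet> u j = 0" if "i \<noteq> j" for i j
  proof -
    have "u i \<noteq> u j" using u that by (auto simp: bij_betw_def inj_on_def)
    then show ?thesis using B(1) uB by (auto simp: pairwise_def orthogonal_def)
  qed
  then have "orthonormal_on UNIV u"
    using B(2)[OF uB] by (auto simp: orthonormal_on_def norm_eq_1)
  then have V: "transpose (cols u) ** cols u = mat 1" by (rule cols_orthonormal)
  have "columns (cols u) = B"
    using u by (auto simp: columns_def column_def cols_def bij_betw_def)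
  then have "range (\<lambda>x. cols u *v x) = range (\<lambda>x. A *v x)"
    using B(5) by (simp flip: span_columns_eq_range)
  then show thesis using that V by blast
qed

lemma cols_bij_orthonormal:
  "orthonormal_on UNIV u \<Longrightarrow> bij \<pi> \<Longrightarrow> orthonormal_on UNIV (u \<circ> \<pi>)"
  by (simp add: orthonormal_on_def bij_def inj_eq)

lemma norm_transpose_orthonormal_le:
  fixes U :: "real^'p^'n"
  assumes "transpose U ** U = mat 1"
  shows "norm (transpose U *v x) \<le> norm x"
proof -
  let ?y = "transpose U *v x"
  have "norm ?y * norm ?y = ?y \<bullet> ?y" by (simp add: dot_square_norm power2_eq_square)
  also have "\<dots> = x \<bullet> (U *v ?y)" by (simp add: inner_matrix_vector_transpose)
  also have "\<dots> \<le> norm x * norm (U *v ?y)" by (rule norm_cauchy_schwarz)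
  also have "\<dots> = norm x * norm ?y" by (simp add: norm_orthogonal_matrix_vector[OF assms])
  finally show ?thesis by (cases "norm ?y = 0") (auto simp: mult_le_cancel_right)
qed

text \<open>
  The singular values of \<open>VA\<^sup>T VB\<close> lie between 0 and 1 because multiplication by \<open>VA\<^sup>T\<close> and \<open>VB\<close> does
  not increase norms. A permutation of the indices puts the angles in increasing order.
\<close>

theorem principal_frames_exist:
  fixes A B :: "real^'n^'n"
  assumes "rank A = CARD('p::{finite,linorder})" "rank B = CARD('p)"
  obtains UA UB :: "real^('p::{finite,linorder})^'n" and \<theta> where "principal_frames A B UA UB \<theta>"
proof -
  obtain VA :: "real^('p::{finite,linorder})^'n" where VA: "transpose VA ** VA = mat 1" "range (\<lambda>x. VA *v x) = range (\<lambda>x. A *v x)"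
    using exists_orthonormal_frame[OF assms(1)] by metis
  obtain VB :: "real^('p::{finite,linorder})^'n" where VB: "transpose VB ** VB = mat 1" "range (\<lambda>x. VB *v x) = range (\<lambda>x. B *v x)"
    using exists_orthonormal_frame[OF assms(2)] by metis
  let ?N = "transpose VA ** VB"
  obtain u v :: "'p \<Rightarrow> real^('p::{finite,linorder})" and s where u: "orthonormal_on UNIV u" and v: "orthonormal_on UNIV v"
    and s0: "\<And>i. 0 \<le> s i" and s: "\<And>i j. u i \<bullet> (?N *v v j) = (if i = j then s i else 0)"
    using singular_value_decomposition[of ?N] by metis
  have s1: "s i \<le> 1" for i
  proof -
    have "s i = u i \<bullet> (?N *v v i)" by (simp add: s)
    also have "\<dots> \<le> norm (u i) * norm (?N *v v i)" by (rule norm_cauchy_schwarz)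
    also have "norm (?N *v v i) = norm (transpose VA *v (VB *v v i))"
      by (simp add: matrix_vector_mul_assoc)
    also have "\<dots> \<le> norm (VB *v v i)" by (rule norm_transpose_orthonormal_le[OF VA(1)])
    also have "\<dots> = norm (v i)" by (rule norm_orthogonal_matrix_vector[OF VB(1)])
    finally show ?thesis
      using u v by (simp add: orthonormal_on_def norm_eq_sqrt_inner mult_left_mono)
  qed
  obtain \<pi> :: "'p \<Rightarrow> 'p" where \<pi>: "bij \<pi>" and mono: "\<And>i j. i \<le> j \<Longrightarrow> arccos (s (\<pi> i)) \<le> arccos (s (\<pi> j))"
    using exists_sorting_bijection[of "\<lambda>i. arccos (s i)"] by metis
  define \<theta> :: "real^('p::{finite,linorder})" where "\<theta> = (\<chi> i. arccos (s (\<pi> i)))"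
  have cos: "cos (\<theta> $ i) = s (\<pi> i)" for i
    using s0[of "\<pi> i"] s1[of "\<pi> i"] by (simp add: \<theta>_def)
  have \<theta>: "\<forall>i. 0 \<le> \<theta> $ i \<and> \<theta> $ i \<le> pi / 2" "\<forall>i j. i \<le> j \<longrightarrow> \<theta> $ i \<le> \<theta> $ j"
    using mono arccos_lbound[OF order_trans[OF _ s0] s1] arccos_le_pi2[OF s0 s1] by (simp_all add: \<theta>_def)
  have O: "orthogonal_matrix (cols (u \<circ> \<pi>))" "orthogonal_matrix (cols (v \<circ> \<pi>))"
    using u v \<pi> by (simp_all add: orthogonal_matrix cols_orthonormal cols_bij_orthonormal)
  have "transpose (cols (u \<circ> \<pi>)) ** ?N ** cols (v \<circ> \<pi>) = diag (\<chi> i. cos (\<theta> $ i))"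
    using \<pi> by (simp only: vec_eq_iff cols_gram) (simp add: s cos diag_nth bij_def inj_eq)
  then have "principal_frames A B (VA ** cols (u \<circ> \<pi>)) (VB ** cols (v \<circ> \<pi>)) \<theta>"
    by (rule principal_framesI[OF \<theta> VA VB O])
  then show thesis by (rule that)
qed

lemma projection_onto_frame:
  fixes U :: "real^'p^'n" and Y :: "real^'q^'n"
  assumes "transpose U ** U = mat 1" "range (\<lambda>x. Y *v x) \<subseteq> range (\<lambda>x. U *v x)"
  shows "U ** transpose U ** Y = Y"
proof -
  have "(U ** transpose U ** Y) *v x = Y *v x" for x
  proof -
    obtain z where z: "Y *v x = U *v z" using assms(2) by blast
    have "(U ** transpose U ** Y) *v x = (U ** transpose U) *v (U *v z)"
      by (simp add: z[symmetric] matrix_vector_mul_assoc)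
    also have "\<dots> = (U ** (transpose U ** U)) *v z" by (simp add: matrix_vector_mul_assoc matrix_mul_assoc)
    also have "\<dots> = Y *v x" by (simp add: assms(1) z)
    finally show ?thesis .
  qed
  then show ?thesis by (simp add: matrix_eq)
qed

lemma frames_of_same_range:
  fixes U V :: "real^'p^'n"
  assumes U: "transpose U ** U = mat 1" and V: "transpose V ** V = mat 1"
    and eq: "range (\<lambda>x. U *v x) = range (\<lambda>x. V *v x)"
  shows "V = U ** (transpose U ** V)" "orthogonal_matrix (transpose U ** V)"
proof -
  show *: "V = U ** (transpose U ** V)"
    using projection_onto_frame[OF U, of V] eq by (simp add: matrix_mul_assoc)
  have "transpose (transpose U ** V) ** (transpose U ** V) = transpose V ** (U ** (transpose U ** V))"
    by (simp add: matrix_transpose_mul matrix_mul_assoc)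
  then show "orthogonal_matrix (transpose U ** V)"
    using V by (simp add: orthogonal_matrix flip: *)
qed

text \<open>
  Any two orthonormal bases of the same range differ by an orthogonal matrix. The uniqueness of ordered
  singular values then forces the angles of the two pairs of frames to agree.
\<close>

lemma principal_frames_change:
  fixes A B :: "real^'n^'n" and UA UB UA' UB' :: "real^('p::{finite,linorder})^'n"
  assumes f: "principal_frames A B UA UB \<theta>" and f': "principal_frames A B UA' UB' \<theta>'"
  obtains Q Q' where "orthogonal_matrix Q" "orthogonal_matrix Q'" "UA' = UA ** Q" "UB' = UB ** Q'"
    "\<theta>' = \<theta>" "transpose Q ** diag (\<chi> i. cos (\<theta> $ i)) ** Q' = diag (\<chi> i. cos (\<theta> $ i))"
proof -
  define Q where "Q = transpose UA ** UA'"
  define Q' where "Q' = transpose UB ** UB'"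
  have Q: "UA' = UA ** Q" "orthogonal_matrix Q"
    using f f' frames_of_same_range[of UA UA'] by (auto simp: principal_frames_iff Q_def)
  have Q': "UB' = UB ** Q'" "orthogonal_matrix Q'"
    using f f' frames_of_same_range[of UB UB'] by (auto simp: principal_frames_iff Q'_def)
  have "diag (\<chi> i. cos (\<theta>' $ i)) = transpose UA' ** UB'" using f' by (simp add: principal_frames_iff)
  also have "\<dots> = transpose Q ** (transpose UA ** UB) ** Q'"
    by (simp add: Q Q' matrix_transpose_mul matrix_mul_assoc)
  finally have eq: "diag (\<chi> i. cos (\<theta>' $ i)) = transpose Q ** diag (\<chi> i. cos (\<theta> $ i)) ** Q'"
    using f by (simp add: principal_frames_iff)
  have angle: "0 \<le> t $ i" "t $ i \<le> pi / 2" "t $ i \<le> pi" "i \<le> j \<Longrightarrow> t $ i \<le> t $ j"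
    if "principal_frames A B V W t" for V W :: "real^('p::{finite,linorder})^'n" and t i j
  proof -
    show "0 \<le> t $ i" "t $ i \<le> pi / 2" "i \<le> j \<Longrightarrow> t $ i \<le> t $ j"
      using that by (auto simp: principal_frames_iff)
    then show "t $ i \<le> pi" using pi_gt_zero by linarith
  qed
  have c: "0 \<le> cos (t $ i)" "i \<le> j \<Longrightarrow> cos (t $ j) \<le> cos (t $ i)"
    if "principal_frames A B V W t" for V W :: "real^('p::{finite,linorder})^'n" and t i j
  proof -
    show "0 \<le> cos (t $ i)"
      using angle(1,2)[OF that, of i] by (intro cos_ge_zero) linarith+
    show "cos (t $ j) \<le> cos (t $ i)" if "i \<le> j"
      using that angle[OF \<open>principal_frames A B V W t\<close>] by (intro cos_monotone_0_pi_le) auto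
  qed
  have "(\<chi> i. cos (\<theta>' $ i)) = (\<chi> i. cos (\<theta> $ i))"
    by (rule ordered_singular_values_unique[OF _ _ _ _ Q(2) Q'(2) eq])
      (use c[OF f] c[OF f'] in auto)
  then have "cos (\<theta>' $ i) = cos (\<theta> $ i)" for i by (simp add: vec_eq_iff)
  then have "\<theta>' $ i = \<theta> $ i" for i
    using angle(1,3)[OF f] angle(1,3)[OF f'] by (metis arccos_cos)
  then have "\<theta>' = \<theta>" by (simp add: vec_eq_iff)
  then show thesis using that[OF Q(2) Q'(2) Q(1) Q'(1)] eq by simp
qed

lemma principal_angles_eq:
  assumes "principal_frames A B UA UB \<theta>"
  shows "principal_angles A B = \<theta>"
  unfolding principal_angles_def
proof (rule the_equality)
  show "\<exists>UA UB. principal_frames A B UA UB \<theta>" using assms by blast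
  show "\<theta>' = \<theta>" if "\<exists>UA UB. principal_frames A B UA UB \<theta>'" for \<theta>'
    
  proof -
    from that obtain UA' UB' where "principal_frames A B UA' UB' \<theta>'" by blast
    from principal_frames_change[OF assms this] show ?thesis by metis
  qed
qed

section \<open>The geometric mean of positive definite matrices\<close>

lemma posdef_iff_psd_injective:
  "posdef M \<longleftrightarrow> psd M \<and> (\<forall>x. M *v x = 0 \<longrightarrow> x = 0)"
proof
  assume M: "posdef M"
  then have "x = 0" if "M *v x = 0" for x
    using that unfolding posdef_def by (metis inner_zero_right less_irrefl)
  with posdef_imp_psd[OF M] show "psd M \<and> (\<forall>x. M *v x = 0 \<longrightarrow> x = 0)" by blast
next
  assume M: "psd M \<and> (\<forall>x. M *v x = 0 \<longrightarrow> x = 0)"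
  have "0 < x \<bullet> (M *v x)" if "x \<noteq> 0" for x
  proof -
    have "x \<bullet> (M *v x) \<noteq> 0" using M that psd_isotropic_vector by blast
    moreover have "0 \<le> x \<bullet> (M *v x)" using M by (simp add: psd_def)
    ultimately show ?thesis by linarith
  qed
  then show "posdef M" using M by (simp add: posdef_def psd_def)
qed

lemma posdef_inverse:
  assumes "posdef M"
  shows "M ** matrix_inv M = mat 1" "matrix_inv M ** M = mat 1"
proof -
  have "\<forall>x. M *v x = 0 \<longrightarrow> x = 0" using assms by (simp add: posdef_iff_psd_injective)
  then obtain B where B: "B ** M = mat 1" using matrix_left_invertible_ker by blast
  then have "M ** B = mat 1" using matrix_left_right_inverse by blast
  with B show "M ** matrix_inv M = mat 1" "matrix_inv M ** M = mat 1"
    by (simp_all add: matrix_inv_unique)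
qed

lemma psd_congruence:
  fixes M :: "real^'n^'n" and C :: "real^'m^'n"
  assumes "psd M"
  shows "psd (transpose C ** M ** C)"
  using assms unfolding psd_def
  by (simp add: inner_congruence matrix_transpose_mul matrix_mul_assoc)

lemma posdef_congruence:
  fixes M :: "real^'n^'n" and C :: "real^'m^'n"
  assumes "posdef M" "\<And>x. C *v x = 0 \<Longrightarrow> x = 0"
  shows "posdef (transpose C ** M ** C)"
  using assms unfolding posdef_def
  by (auto simp add: inner_congruence matrix_transpose_mul matrix_mul_assoc)

lemma posdef_matrix_inv:
  assumes "posdef M"
  shows "posdef (matrix_inv M)"
proof -
  note inv = posdef_inverse[OF assms]
  have "transpose (matrix_inv M) ** M = transpose (M ** matrix_inv M)"
    using assms by (simp add: matrix_transpose_mul posdef_symmetric)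
  then have "transpose (matrix_inv M) ** M = mat 1" by (simp add: inv)
  then have sym: "transpose (matrix_inv M) = matrix_inv M"
    by (metis inv(1) matrix_mul_assoc matrix_mul_lid matrix_mul_rid)
  have "transpose (matrix_inv M) ** M ** matrix_inv M = matrix_inv M"
    by (simp add: sym inv)
  moreover have "posdef (transpose (matrix_inv M) ** M ** matrix_inv M)"
  proof (rule posdef_congruence[OF assms])
    fix x assume "matrix_inv M *v x = 0"
    then have "M *v (matrix_inv M *v x) = 0" by simp
    then show "x = 0" by (simp add: matrix_vector_mul_assoc inv)
  qed
  ultimately show ?thesis by simp
qed

lemma psd_add: "psd M \<Longrightarrow> psd N \<Longrightarrow> psd (M + N)"
  by (simp add: psd_def transpose_add_diff matrix_vector_mult_add_rdistrib inner_add_right)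

lemma psd_scaleR: "psd M \<Longrightarrow> 0 \<le> c \<Longrightarrow> psd (c *\<^sub>R M)"
  by (simp add: psd_def transpose_scalar scaleR_matrix_vector_assoc[symmetric])

lemma posdef_scaleR: "posdef M \<Longrightarrow> 0 < c \<Longrightarrow> posdef (c *\<^sub>R M)"
  by (simp add: posdef_def transpose_scalar scaleR_matrix_vector_assoc[symmetric])

lemma posdef_square_root_exists:
  assumes "posdef M"
  obtains R where "posdef R" "R ** R = M"
proof -
  obtain R where R: "psd R" "R ** R = M"
    using psd_square_root_exists posdef_imp_psd[OF assms] by metis
  have "x = 0" if "R *v x = 0" for x
  proof -
    have "M *v x = R *v (R *v x)" by (simp add: R(2)[symmetric] matrix_vector_mul_assoc)
    then show ?thesis using assms that by (simp add: posdef_iff_psd_injective)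
  qed
  then have "posdef R" using R(1) by (simp add: posdef_iff_psd_injective)
  then show thesis using R(2) by (rule that)
qed

text \<open>
  With \<open>z = G\<^sup>-\<^sup>1 x\<close> and \<open>y = G'\<^sup>-\<^sup>1 x\<close>, expanding \<open>0 \<le> (y - z) \<bullet> G (y - z)\<close> and using
  \<open>y \<bullet> G y \<le> y \<bullet> G' y = x \<bullet> y\<close> leaves \<open>x \<bullet> y \<le> x \<bullet> z\<close>.
\<close>

lemma matrix_inv_antimono:
  assumes G: "posdef G" and G': "posdef G'" and le: "loewner_le G G'"
  shows "loewner_le (matrix_inv G') (matrix_inv G)"
proof -
  have "0 \<le> x \<bullet> ((matrix_inv G - matrix_inv G') *v x)" for x
  proof -
    define y where "y = matrix_inv G' *v x"
    define z where "z = matrix_inv G *v x"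
    have Gz: "G *v z = x" "G' *v y = x"
      by (simp_all add: y_def z_def matrix_vector_mul_assoc posdef_inverse G G')
    have "0 \<le> (y - z) \<bullet> (G *v (y - z))"
      using posdef_imp_psd[OF G] by (simp add: psd_def)
    also have "\<dots> = y \<bullet> (G *v y) - 2 * (x \<bullet> y) + x \<bullet> z"
      using symmetric_inner_commute[OF posdef_symmetric[OF G], of z y]
      by (simp add: matrix_vector_mult_diff_distrib inner_diff_left inner_diff_right Gz inner_commute)
    also have "y \<bullet> (G *v y) \<le> y \<bullet> (G' *v y)"
    proof -
      have "0 \<le> y \<bullet> ((G' - G) *v y)" using le by (simp add: loewner_le_def psd_def)
      then show ?thesis by (simp add: matrix_vector_mult_diff_rdistrib inner_diff_right)
    qed
    finally show ?thesis
      by (simp add: Gz matrix_vector_mult_diff_rdistrib inner_diff_right inner_commute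
          flip: y_def z_def)
  qed
  then show ?thesis
    using posdef_symmetric[OF posdef_matrix_inv[OF G]] posdef_symmetric[OF posdef_matrix_inv[OF G']]
    by (simp add: loewner_le_def psd_def transpose_add_diff)
qed

text \<open>
  The formula that defines the geometric mean of \<open>R\<^sup>2\<close> and \<open>H\<close> solves the Riccati equation
  \<open>K G\<^sup>-\<^sup>1 K = H\<close> with \<open>G = R\<^sup>2\<close>; this equation no longer mentions square roots.
\<close>

lemma riccati_solution:
  assumes R: "posdef R" and H: "posdef H"
  defines "K \<equiv> R ** psd_sqrt (matrix_inv R ** H ** matrix_inv R) ** R"
  shows "posdef K" "K ** matrix_inv (R ** R) ** K = H"
proof -
  note inv = posdef_inverse[OF R]
  let ?Ri = "matrix_inv R"
  have Risym: "transpose ?Ri = ?Ri" by (rule posdef_symmetric[OF posdef_matrix_inv[OF R]])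
  have inj: "x = 0" if "S *v x = 0" "posdef S" for x and S :: "real^'a^'a"
    using that by (simp add: posdef_iff_psd_injective)
  have "posdef (transpose ?Ri ** H ** ?Ri)"
    by (rule posdef_congruence[OF H]) (use inj posdef_matrix_inv[OF R] in blast)
  then have "posdef (?Ri ** H ** ?Ri)" by (simp add: Risym)
  then obtain Y where Y: "posdef Y" "Y ** Y = ?Ri ** H ** ?Ri"
    using posdef_square_root_exists by metis
  then have K: "K = R ** Y ** R"
    unfolding K_def using psd_sqrt_eqI[OF posdef_imp_psd] by metis
  have "posdef (transpose R ** Y ** R)"
    by (rule posdef_congruence[OF Y(1)]) (use inj R in blast)
  then show "posdef K" by (simp add: K posdef_symmetric[OF R])
  have "(R ** R) ** (?Ri ** ?Ri) = mat 1"
    by (simp add: matrix_mul_assoc matrix_mul_cancel_right[OF inv(1)] inv)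
  then have "matrix_inv (R ** R) = ?Ri ** ?Ri" by (rule matrix_inv_unique)
  then have "K ** matrix_inv (R ** R) ** K = R ** (Y ** Y) ** R"
    by (simp add: K matrix_mul_assoc matrix_mul_cancel_right[OF inv(1)] matrix_mul_cancel_right[OF inv(2)])
  also have "\<dots> = H"
    by (simp add: Y matrix_mul_assoc matrix_mul_cancel_right[OF inv(2)] inv)
  finally show "K ** matrix_inv (R ** R) ** K = H" .
qed

text \<open>
  Enlarging \<open>G\<close> to \<open>G'\<close> shrinks the inverse, so \<open>X' G\<^sup>-\<^sup>1 X' \<ge> X' G'\<^sup>-\<^sup>1 X' \<ge> X G\<^sup>-\<^sup>1 X\<close>. After conjugation
  with \<open>R\<^sup>-\<^sup>1\<close>, where \<open>G = R\<^sup>2\<close>, both ends become squares, and the square root is operator monotone.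
  With \<open>G = G'\<close> and equal right-hand sides, applied in both directions, it yields uniqueness.
\<close>

lemma riccati_monotone:
  assumes G: "posdef G" "posdef G'" "loewner_le G G'" and X: "psd X" "psd X'"
    and le: "loewner_le (X ** matrix_inv G ** X) (X' ** matrix_inv G' ** X')"
  shows "loewner_le X X'"
proof -
  obtain R where R: "posdef R" "R ** R = G" using posdef_square_root_exists[OF G(1)] by metis
  let ?Ri = "matrix_inv R"
  note inv = posdef_inverse[OF R(1)]
  have Rsym: "transpose R = R" "transpose ?Ri = ?Ri"
    using R posdef_matrix_inv posdef_symmetric by auto
  have "G ** (?Ri ** ?Ri) = mat 1"
    unfolding R(2)[symmetric]
    by (simp add: matrix_mul_assoc matrix_mul_cancel_right[OF inv(1)] inv)
  then have Gi: "matrix_inv G = ?Ri ** ?Ri" by (rule matrix_inv_unique)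
  have psdY: "psd (?Ri ** Z ** ?Ri)" if "psd Z" for Z
    using psd_congruence[OF that, of ?Ri] by (simp add: Rsym)
  have sq: "(?Ri ** Z ** ?Ri) ** (?Ri ** Z ** ?Ri) = ?Ri ** (Z ** matrix_inv G ** Z) ** ?Ri" for Z
    by (simp add: Gi matrix_mul_assoc)
  let ?D = "X' ** matrix_inv G' ** X' - X ** matrix_inv G ** X"
  have "psd (transpose X' ** (matrix_inv G - matrix_inv G') ** X' + ?D)"
    using matrix_inv_antimono[OF G] le by (intro psd_add psd_congruence) (simp_all add: loewner_le_def)
  moreover have "transpose X' ** (matrix_inv G - matrix_inv G') ** X' + ?D
      = X' ** matrix_inv G ** X' - X ** matrix_inv G ** X"
    by (simp add: psd_symmetric[OF X(2)] matrix_mul_diff_distrib)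
  ultimately have "psd (?Ri ** (X' ** matrix_inv G ** X' - X ** matrix_inv G ** X) ** ?Ri)"
    by (simp add: psdY)
  then have "loewner_le ((?Ri ** X ** ?Ri) ** (?Ri ** X ** ?Ri)) ((?Ri ** X' ** ?Ri) ** (?Ri ** X' ** ?Ri))"
    unfolding sq loewner_le_def by (simp add: matrix_mul_diff_distrib)
  then have "loewner_le (?Ri ** X ** ?Ri) (?Ri ** X' ** ?Ri)"
    by (rule psd_square_root_monotone[OF psdY[OF X(1)] psdY[OF X(2)]])
  then have "psd (transpose R ** (?Ri ** X' ** ?Ri - ?Ri ** X ** ?Ri) ** R)"
    unfolding loewner_le_def by (rule psd_congruence)
  moreover have "R ** (?Ri ** Z ** ?Ri) ** R = Z" for Z
    by (simp add: matrix_mul_assoc inv matrix_mul_cancel_right[OF inv(2)])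
  ultimately show ?thesis by (simp add: loewner_le_def Rsym matrix_mul_diff_distrib)
qed

text \<open>
  The geometric mean of two positive definite matrices, described by its Riccati equation rather than
  by a formula with square roots: symmetry, inversion, scaling and congruence can then be read off by
  checking that a candidate satisfies the equation.
\<close>

definition spd_mean :: "real^'n^'n \<Rightarrow> real^'n^'n \<Rightarrow> real^'n^'n" where
  "spd_mean G H = (THE X. posdef X \<and> X ** matrix_inv G ** X = H)"

lemma spd_mean_eqI:
  assumes G: "posdef G" and X: "posdef X" "X ** matrix_inv G ** X = H"
  shows "spd_mean G H = X"
  unfolding spd_mean_def
proof (rule the_equality)
  fix Z assume Z: "posdef Z \<and> Z ** matrix_inv G ** Z = H"
  show "Z = X"
    by (rule loewner_le_antisym; rule riccati_monotone[OF G G loewner_le_refl])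
      (simp_all add: X Z posdef_imp_psd loewner_le_refl)
qed (use X in blast)

lemma spd_mean_root_formula:
  assumes "posdef R" "posdef H"
  shows "R ** psd_sqrt (matrix_inv R ** H ** matrix_inv R) ** R = spd_mean (R ** R) H"
proof -
  have "posdef (transpose R ** mat 1 ** R)"
    using assms(1)
    by (intro posdef_congruence) (auto simp: posdef_iff_psd_injective psd_def)
  then have "posdef (R ** R)" using assms(1) by (simp add: posdef_symmetric)
  from spd_mean_eqI[OF this riccati_solution[OF assms]] show ?thesis by simp
qed

lemma spd_mean_riccati:
  assumes G: "posdef G" and H: "posdef H"
  shows "posdef (spd_mean G H)" "spd_mean G H ** matrix_inv G ** spd_mean G H = H"
proof -
  obtain R where R: "posdef R" "R ** R = G" using posdef_square_root_exists[OF G] by metis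
  note sol = riccati_solution[OF R(1) H]
  have "spd_mean G H = R ** psd_sqrt (matrix_inv R ** H ** matrix_inv R) ** R"
    using spd_mean_root_formula[OF R(1) H] R(2) by simp
  with sol R(2) show "posdef (spd_mean G H)" "spd_mean G H ** matrix_inv G ** spd_mean G H = H"
    by simp_all
qed

lemma spd_mean_mono:
  assumes "posdef G" "posdef G'" "posdef H" "posdef H'" "loewner_le G G'" "loewner_le H H'"
  shows "loewner_le (spd_mean G H) (spd_mean G' H')"
  by (rule riccati_monotone[of G G']) (simp_all add: assms spd_mean_riccati posdef_imp_psd)

lemma spd_mean_inverse:
  assumes G: "posdef G" and H: "posdef H"
  shows "spd_mean (matrix_inv G) (matrix_inv H) = matrix_inv (spd_mean G H)"
proof (rule spd_mean_eqI)
  let ?X = "spd_mean G H"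
  note X = spd_mean_riccati[OF G H]
  note inv = posdef_inverse[OF X(1)]
  have GG: "matrix_inv (matrix_inv G) = G" by (rule matrix_inv_unique) (rule posdef_inverse[OF G])
  have "H ** (matrix_inv ?X ** G ** matrix_inv ?X)
      = (?X ** matrix_inv G ** ?X) ** (matrix_inv ?X ** G ** matrix_inv ?X)"
    by (simp only: X(2))
  also have "\<dots> = mat 1"
    by (simp add: matrix_mul_assoc matrix_mul_cancel_right[OF inv(1)]
        matrix_mul_cancel_right[OF posdef_inverse(2)[OF G]] inv)
  finally have "matrix_inv H = matrix_inv ?X ** G ** matrix_inv ?X" by (rule matrix_inv_unique)
  then show "matrix_inv ?X ** matrix_inv (matrix_inv G) ** matrix_inv ?X = matrix_inv H"
    by (simp add: GG)
qed (simp_all add: posdef_matrix_inv spd_mean_riccati G H)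

text \<open>
  Inverting \<open>X G\<^sup>-\<^sup>1 X = H\<close> gives \<open>X\<^sup>-\<^sup>1 G X\<^sup>-\<^sup>1 = H\<^sup>-\<^sup>1\<close>, that is, \<open>X H\<^sup>-\<^sup>1 X = G\<close>.
\<close>

lemma spd_mean_commute:
  assumes G: "posdef G" and H: "posdef H"
  shows "spd_mean H G = spd_mean G H"
proof (rule spd_mean_eqI[OF H])
  let ?X = "spd_mean G H"
  note inv = posdef_inverse[OF spd_mean_riccati(1)[OF G H]]
  have "matrix_inv H = matrix_inv ?X ** matrix_inv (matrix_inv G) ** matrix_inv ?X"
    using spd_mean_riccati(2)[OF posdef_matrix_inv[OF G] posdef_matrix_inv[OF H]]
    by (simp add: spd_mean_inverse[OF G H])
  moreover have "matrix_inv (matrix_inv G) = G" by (rule matrix_inv_unique) (rule posdef_inverse[OF G])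
  ultimately show "?X ** matrix_inv H ** ?X = G"
    by (simp add: matrix_mul_assoc inv matrix_mul_cancel_right[OF inv(2)])
qed (rule spd_mean_riccati[OF G H])

lemma spd_mean_scaleR:
  assumes G: "posdef G" and H: "posdef H" and "0 < a" "0 < b"
  shows "spd_mean (a *\<^sub>R G) (b *\<^sub>R H) = sqrt (a * b) *\<^sub>R spd_mean G H"
proof (rule spd_mean_eqI)
  have "matrix_inv (a *\<^sub>R G) = (1 / a) *\<^sub>R matrix_inv G"
    using assms by (intro matrix_inv_unique) (simp add: posdef_inverse)
  then show "(sqrt (a * b) *\<^sub>R spd_mean G H) ** matrix_inv (a *\<^sub>R G) ** (sqrt (a * b) *\<^sub>R spd_mean G H)
      = b *\<^sub>R H"
    using assms by (simp add: spd_mean_riccati)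
qed (use assms in \<open>simp_all add: posdef_scaleR spd_mean_riccati\<close>)

lemma spd_mean_orthogonal_congruence:
  assumes G: "posdef G" and H: "posdef H" and Q: "orthogonal_matrix Q"
  shows "spd_mean (transpose Q ** G ** Q) (transpose Q ** H ** Q) = transpose Q ** spd_mean G H ** Q"
proof (rule spd_mean_eqI)
  have QQ: "transpose Q ** Q = mat 1" "Q ** transpose Q = mat 1"
    using Q by (simp_all add: orthogonal_matrix_def)
  have pd: "posdef (transpose Q ** M ** Q)" if "posdef M" for M
    by (rule posdef_congruence[OF that])
      (metis QQ(1) matrix_vector_mul_assoc matrix_vector_mul_lid matrix_vector_mult_0_right)
  show "posdef (transpose Q ** G ** Q)" "posdef (transpose Q ** spd_mean G H ** Q)"
    using G H by (simp_all add: pd spd_mean_riccati)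
  have "(transpose Q ** G ** Q) ** (transpose Q ** matrix_inv G ** Q) = mat 1"
    by (simp add: matrix_mul_assoc matrix_mul_cancel_right[OF QQ(2)]
        matrix_mul_cancel_right[OF posdef_inverse(1)[OF G]] QQ)
  then have "matrix_inv (transpose Q ** G ** Q) = transpose Q ** matrix_inv G ** Q"
    by (rule matrix_inv_unique)
  then have "(transpose Q ** spd_mean G H ** Q) ** matrix_inv (transpose Q ** G ** Q)
        ** (transpose Q ** spd_mean G H ** Q)
      = transpose Q ** (spd_mean G H ** matrix_inv G ** spd_mean G H) ** Q"
    by (simp add: matrix_mul_assoc matrix_mul_cancel_right[OF QQ(2)])
  then show "(transpose Q ** spd_mean G H ** Q) ** matrix_inv (transpose Q ** G ** Q)
        ** (transpose Q ** spd_mean G H ** Q) = transpose Q ** H ** Q"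
    by (simp add: spd_mean_riccati G H)
qed

section \<open>Pseudoinverses\<close>

text \<open>
  Uniqueness of the Moore--Penrose inverse: the symmetric idempotents \<open>A X\<close> and \<open>A Y\<close> absorb each
  other in one order, hence, by transposition, in both orders and are equal. The same holds for \<open>X A\<close>
  and \<open>Y A\<close>.
\<close>

lemma pseudoinverse_eqI:
  assumes X: "is_pseudoinverse A X"
  shows "pseudoinverse A = X"
  unfolding pseudoinverse_def
proof (rule the_equality)
  fix Y assume Y: "is_pseudoinverse A Y"
  note facts = X[unfolded is_pseudoinverse_def] Y[unfolded is_pseudoinverse_def]
  have "A ** X = transpose ((A ** Y) ** (A ** X))"
    using facts by (simp add: matrix_mul_assoc)
  also have "\<dots> = (A ** X) ** (A ** Y)"
    using facts by (simp add: matrix_transpose_mul[of "A ** Y"])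
  also have "\<dots> = A ** Y" using facts by (simp add: matrix_mul_assoc)
  finally have AX: "A ** X = A ** Y" .
  have "X ** A = transpose ((X ** A) ** (Y ** A))"
    using facts by (simp add: matrix_mul_assoc) (simp add: matrix_mul_assoc[symmetric])
  also have "\<dots> = (Y ** A) ** (X ** A)"
    using facts by (simp add: matrix_transpose_mul[of "X ** A"])
  also have "\<dots> = Y ** A" using facts by (simp add: matrix_mul_assoc) (simp add: matrix_mul_assoc[symmetric])
  finally have XA: "X ** A = Y ** A" .
  have "X = X ** A ** X" using facts by simp
  also have "\<dots> = Y ** A ** Y" by (simp add: XA AX flip: matrix_mul_assoc)
  finally show "Y = X" using facts by simp
qed (rule X)

lemma pseudoinverse_diag: "pseudoinverse (diag v) = diag (\<chi> i. inverse (v $ i))"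
  by (rule pseudoinverse_eqI) (auto simp: is_pseudoinverse_def diag_mul_diag vec_eq_iff diag_nth mult.commute[of "inverse _"]
      intro: ccontr)

lemma pseudoinverse_in_frame:
  fixes U :: "real^'p^'n"
  assumes U: "transpose U ** U = mat 1" and G: "posdef G"
  shows "pseudoinverse (U ** G ** transpose U) = U ** matrix_inv G ** transpose U"
proof (rule pseudoinverse_eqI)
  note inv = posdef_inverse[OF G]
  have "(U ** G ** transpose U) ** (U ** matrix_inv G ** transpose U) = U ** transpose U"
    "(U ** matrix_inv G ** transpose U) ** (U ** G ** transpose U) = U ** transpose U"
    by (simp_all add: matrix_mul_assoc matrix_mul_cancel_right[OF U] matrix_mul_cancel_right[OF inv(1)]
        matrix_mul_cancel_right[OF inv(2)])
  then show "is_pseudoinverse (U ** G ** transpose U) (U ** matrix_inv G ** transpose U)"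
    by (simp add: is_pseudoinverse_def matrix_mul_assoc matrix_mul_cancel_right[OF U] matrix_transpose_mul)
qed

section \<open>Ranges of semidefinite matrices\<close>

text \<open>
  A semidefinite matrix is positive definite on its range, because a vector of the range that is
  isotropic lies in the kernel, which is orthogonal to the range.
\<close>

lemma posdef_compression:
  fixes U :: "real^'p^'n"
  assumes A: "psd A" and U: "transpose U ** U = mat 1" "range (\<lambda>x. U *v x) = range (\<lambda>x. A *v x)"
  shows "posdef (transpose U ** A ** U)" "U ** (transpose U ** A ** U) ** transpose U = A"
proof -
  have "x = 0" if "(transpose U ** A ** U) *v x = 0" for x
  proof -
    have "(U *v x) \<bullet> (A *v (U *v x)) = 0" using inner_congruence[of x U A] that by simp
    then have 0: "A *v (U *v x) = 0" by (rule psd_isotropic_vector[OF A])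
    obtain y where y: "U *v x = A *v y" using U(2) by blast
    have "(U *v x) \<bullet> (U *v x) = y \<bullet> (A *v (U *v x))"
      by (metis y inner_commute symmetric_inner_commute[OF psd_symmetric[OF A]])
    then have "U *v x = 0" by (simp add: 0)
    then show "x = 0"
      by (metis U(1) matrix_vector_mul_assoc matrix_vector_mul_lid matrix_vector_mult_0_right)
  qed
  then show "posdef (transpose U ** A ** U)"
    by (simp add: posdef_iff_psd_injective psd_congruence[OF A])
  have UA: "U ** transpose U ** A = A" by (rule projection_onto_frame) (simp_all add: U)
  then have "transpose (U ** transpose U ** A) = transpose A" by simp
  then have "A ** (U ** transpose U) = A"
    by (simp add: matrix_transpose_mul psd_symmetric[OF A])
  then show "U ** (transpose U ** A ** U) ** transpose U = A"
    by (simp add: matrix_mul_assoc UA)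
qed

lemma range_in_frame:
  fixes U :: "real^'p^'n"
  assumes "transpose U ** U = mat 1" "G ** G' = mat 1"
  shows "range (\<lambda>x. (U ** G ** transpose U) *v x) = range (\<lambda>x. U *v x)"
  using range_mul_right_surj[OF assms(1), of "U ** G"] range_mul_right_surj[OF assms(2), of U] by simp

lemma range_symmetric_eq_kernel_complement:
  fixes A :: "real^'n^'n"
  assumes "transpose A = A"
  shows "range (\<lambda>x. A *v x) = {x. A *v x = 0}\<^sup>\<bottom>"
proof -
  have "(\<lambda>x. A *v x) -` {0} = (range (\<lambda>x. A *v x))\<^sup>\<bottom>"
    using ker_orthogonal_comp_adjoint[of "\<lambda>x. A *v x"] by (simp add: adjoint_matrix assms)
  moreover have "subspace (range (\<lambda>x. A *v x))"
    by (intro linear_subspace_image matrix_vector_mul_linear subspace_UNIV)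
  ultimately show ?thesis by (simp add: vimage_def orthogonal_comp_self)
qed

text \<open>
  \<open>A \<le> A'\<close> makes the kernel of \<open>A'\<close> part of the kernel of \<open>A\<close>, hence the range of \<open>A\<close> part of the range
  of \<open>A'\<close>; equal rank turns the inclusion into equality.
\<close>

lemma loewner_le_same_rank_imp_same_range:
  assumes A: "psd A" and A': "psd A'" and le: "loewner_le A A'" and rk: "rank A = rank A'"
  shows "range (\<lambda>x. A *v x) = range (\<lambda>x. A' *v x)"
proof (rule subspace_dim_equal)
  have "A *v x = 0" if "A' *v x = 0" for x
  proof (rule psd_isotropic_vector[OF A])
    have "0 \<le> x \<bullet> ((A' - A) *v x)" "0 \<le> x \<bullet> (A *v x)"
      using le A by (simp_all add: loewner_le_def psd_def)
    then show "x \<bullet> (A *v x) = 0"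
      using that by (simp add: matrix_vector_mult_diff_rdistrib inner_diff_right)
  qed
  then have "{x. A' *v x = 0} \<subseteq> {x. A *v x = 0}" by blast
  then show "range (\<lambda>x. A *v x) \<subseteq> range (\<lambda>x. A' *v x)"
    unfolding range_symmetric_eq_kernel_complement[OF psd_symmetric[OF A]]
      range_symmetric_eq_kernel_complement[OF psd_symmetric[OF A']]
    by (rule orthogonal_comp_anti_mono)
  show "dim (range (\<lambda>x. A' *v x)) \<le> dim (range (\<lambda>x. A *v x))"
    using rk by (simp add: rank_dim_range)
qed (intro linear_subspace_image matrix_vector_mul_linear subspace_UNIV)+

section \<open>The geodesic midpoint of two subspaces\<close>

text \<open>
  The columns are the normalized bisectors of the paired principal vectors: two unit vectors at angle
  \<open>t\<close> have a sum of length \<open>2 cos (t / 2)\<close>.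
\<close>

definition midpoint_frame :: "real^'p^'n \<Rightarrow> real^'p^'n \<Rightarrow> real^'p \<Rightarrow> real^'p^'n" where
  "midpoint_frame UA UB \<theta> = (UA + UB) ** diag (\<chi> i. 1 / (2 * cos (\<theta> $ i / 2)))"

lemma midpoint_frame_commute: "midpoint_frame UB UA \<theta> = midpoint_frame UA UB \<theta>"
  by (simp add: midpoint_frame_def add.commute)

lemma half_angle_cos_pos: "0 \<le> t \<Longrightarrow> t \<le> pi / 2 \<Longrightarrow> 0 < cos (t / 2)"
  by (rule cos_gt_zero_pi) (use pi_gt_zero in linarith)+

lemma principal_frames_swap:
  assumes "principal_frames A B UA UB \<theta>"
  shows "principal_frames B A UB UA \<theta>"
proof -
  have "transpose UB ** UA = transpose (transpose UA ** UB)" by (simp add: matrix_transpose_mul)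
  then show ?thesis using assms by (simp add: principal_frames_iff)
qed

lemma principal_frames_cong:
  assumes "range (\<lambda>x. A *v x) = range (\<lambda>x. A' *v x)" "range (\<lambda>x. B *v x) = range (\<lambda>x. B' *v x)"
  shows "principal_frames A B UA UB \<theta> \<longleftrightarrow> principal_frames A' B' UA UB \<theta>"
  by (simp add: principal_frames_iff assms)

text \<open>
  The Gram matrix of \<open>UA + UB\<close> is diagonal with entries \<open>2 + 2 cos t = (2 cos (t / 2))\<^sup>2\<close>, which the
  diagonal factor normalizes.
\<close>

lemma midpoint_frame_orthonormal:
  assumes f: "principal_frames A B UA UB \<theta>"
  shows "transpose (midpoint_frame UA UB \<theta>) ** midpoint_frame UA UB \<theta> = mat 1"
proof -
  define E where "E = diag (\<chi> i. 1 / (2 * cos (\<theta> $ i / 2)))"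
  define D where "D = diag (\<chi> i. cos (\<theta> $ i))"
  have g: "transpose UA ** UA = mat 1" "transpose UB ** UB = mat 1"
    "transpose UA ** UB = D" "transpose UB ** UA = D"
    using f principal_frames_swap[OF f] by (simp_all add: principal_frames_iff D_def)
  have gram: "transpose (UA + UB) ** (UA + UB) = (mat 1 + D) + (D + mat 1)"
    by (simp only: transpose_add_diff matrix_mul_add_distrib g)
  have "transpose ((UA + UB) ** E) ** ((UA + UB) ** E) = E ** (transpose (UA + UB) ** (UA + UB)) ** E"
    by (simp add: E_def matrix_transpose_mul matrix_mul_assoc)
  also have "\<dots> = E ** ((mat 1 + D) + (D + mat 1)) ** E" by (simp only: gram)
  also have "\<dots> = mat 1"
  proof -
    have "(E ** ((mat 1 + D) + (D + mat 1)) ** E) $ i $ j = mat 1 $ i $ j" for i j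
    proof -
      have pos: "0 < cos (\<theta> $ j / 2)"
        using f by (intro half_angle_cos_pos) (auto simp: principal_frames_iff)
      have "cos (\<theta> $ j) = 2 * (cos (\<theta> $ j / 2))^2 - 1"
        using cos_double_cos[of "\<theta> $ j / 2"] by simp
      then show ?thesis
        using pos unfolding E_def D_def
        by (simp add: diag_mul_nth mul_diag_nth diag_nth mat_def) (simp add: field_simps power2_eq_square)
    qed
    then show ?thesis by (simp add: vec_eq_iff)
  qed
  finally show ?thesis by (simp add: midpoint_frame_def E_def)
qed

text \<open>
  The point at parameter \<open>1/2\<close> on the geodesic of the Grassmannian from \<open>UA\<close> to \<open>UB\<close> has the bisectors as
  its columns, which makes it symmetric in the two frames. For angle \<open>0\<close> the pseudoinverse contributes
  \<open>0\<close> and the formula keeps the column of \<open>UA\<close>; it is then equal to that of \<open>UB\<close>.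
\<close>

lemma geodesic_midpoint_eq_midpoint_frame:
  assumes f: "principal_frames A B UA UB \<theta>"
  shows "UA ** diag (\<chi> i. cos (\<theta> $ i / 2))
      + (mat 1 - UA ** transpose UA) ** UB ** pseudoinverse (diag (\<chi> i. sin (\<theta> $ i)))
          ** diag (\<chi> i. sin (\<theta> $ i / 2))
    = midpoint_frame UA UB \<theta>" (is "?L = _")
proof -
  have g: "transpose UA ** UA = mat 1" "transpose UB ** UB = mat 1"
    "transpose UA ** UB = diag (\<chi> i. cos (\<theta> $ i))" "transpose UB ** UA = diag (\<chi> i. cos (\<theta> $ i))"
    using f principal_frames_swap[OF f] by (simp_all add: principal_frames_iff)
  have same_column: "UA $ a $ i = UB $ a $ i" if "\<theta> $ i = 0" for a i
  proof -
    have "(\<Sum>a\<in>UNIV. (UA $ a $ i - UB $ a $ i)^2) = (transpose (UA - UB) ** (UA - UB)) $ i $ i"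
      by (simp add: matrix_matrix_mult_def transpose_def power2_eq_square)
    also have "\<dots> = 0"
      using that by (simp add: transpose_add_diff matrix_mul_diff_distrib g) (simp add: diag_nth mat_def)
    finally show ?thesis by (simp add: sum_nonneg_eq_0_iff)
  qed
  have "(mat 1 - UA ** transpose UA) ** UB = UB - UA ** diag (\<chi> i. cos (\<theta> $ i))"
    by (simp add: matrix_mul_diff_distrib matrix_mul_cancel_right[OF g(3)])
  then have L: "?L = UA ** diag (\<chi> i. cos (\<theta> $ i / 2))
      + (UB - UA ** diag (\<chi> i. cos (\<theta> $ i))) ** diag (\<chi> i. inverse (sin (\<theta> $ i)))
        ** diag (\<chi> i. sin (\<theta> $ i / 2))"
    by (simp add: pseudoinverse_diag)
  have "?L $ a $ i = midpoint_frame UA UB \<theta> $ a $ i" for a i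
  proof -
    let ?t = "\<theta> $ i"
    have t: "0 \<le> ?t" "?t \<le> pi / 2" using f by (auto simp: principal_frames_iff)
    have pos: "0 < cos (?t / 2)" using t by (rule half_angle_cos_pos)
    have Li: "?L $ a $ i = UA $ a $ i * cos (?t / 2)
        + (UB $ a $ i - UA $ a $ i * cos ?t) * inverse (sin ?t) * sin (?t / 2)"
      unfolding L by (simp add: mul_diag_nth)
    have Ri: "midpoint_frame UA UB \<theta> $ a $ i = (UA $ a $ i + UB $ a $ i) / (2 * cos (?t / 2))"
      by (simp add: midpoint_frame_def mul_diag_nth)
    show ?thesis
    proof (cases "?t = 0")
      case True
      then show ?thesis unfolding Li Ri by (simp add: same_column)
    next
      case False
      then have s: "0 < sin (?t / 2)" using t pi_gt_zero by (intro sin_gt_zero) linarith+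
      have dbl: "sin ?t = 2 * sin (?t / 2) * cos (?t / 2)" "cos ?t = 2 * (cos (?t / 2))^2 - 1"
        using sin_double[of "?t / 2"] cos_double_cos[of "?t / 2"] by simp_all
      show ?thesis
        unfolding Li Ri dbl using s pos by (simp add: field_simps power2_eq_square)
    qed
  qed
  then show ?thesis by (simp add: vec_eq_iff)
qed

section \<open>Independence of the mean from the frames\<close>

definition mean_in_frames ::
  "real^'n^'n \<Rightarrow> real^'n^'n \<Rightarrow> real^'p^'n \<Rightarrow> real^'p^'n \<Rightarrow> real^'p \<Rightarrow> real^'n^'n" where
  "mean_in_frames A B UA UB \<theta> = midpoint_frame UA UB \<theta>
     ** spd_mean (transpose UA ** A ** UA) (transpose UB ** B ** UB)
     ** transpose (midpoint_frame UA UB \<theta>)"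

lemma posdef_frame_compressions:
  assumes "psd A" "psd B" "principal_frames A B UA UB \<theta>"
  shows "posdef (transpose UA ** A ** UA)" "posdef (transpose UB ** B ** UB)"
  using assms posdef_compression[of A UA] posdef_compression[of B UB]
  by (simp_all add: principal_frames_iff)

lemma is_geometric_mean_midpoint:
  fixes A B M :: "real^'n^'n"
  shows "is_geometric_mean TYPE('p::{finite,linorder}) A B M \<longleftrightarrow>
    (\<exists>(UA :: real^('p::{finite,linorder})^'n) UB \<theta> RA RB.
        principal_frames A B UA UB \<theta> \<and>
        posdef RA \<and> RA ** RA = transpose UA ** A ** UA \<and>
        posdef RB \<and> RB ** RB = transpose UB ** B ** UB \<and>
        M = midpoint_frame UA UB \<theta>
          ** (RA ** psd_sqrt (matrix_inv RA ** (RB ** RB) ** matrix_inv RA) ** RA)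
          ** transpose (midpoint_frame UA UB \<theta>))"
  unfolding is_geometric_mean_def Let_def
  by (intro ex_cong1 conj_cong refl) (simp only: geodesic_midpoint_eq_midpoint_frame)

text \<open>
  The square roots \<open>RA\<close> and \<open>RB\<close> exist and enter only through their squares, so the frames and angles
  are the only choices on which the mean could depend.
\<close>

lemma is_geometric_mean_iff:
  fixes A B M :: "real^'n^'n"
  assumes A: "psd A" and B: "psd B"
  shows "is_geometric_mean TYPE('p::{finite,linorder}) A B M \<longleftrightarrow>
    (\<exists>(UA :: real^('p::{finite,linorder})^'n) UB \<theta>.
        principal_frames A B UA UB \<theta> \<and> M = mean_in_frames A B UA UB \<theta>)"
proof
  assume "is_geometric_mean TYPE('p::{finite,linorder}) A B M"
  then obtain UA UB :: "real^('p::{finite,linorder})^'n" and \<theta> RA RB where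
    f: "principal_frames A B UA UB \<theta>"
    and R: "posdef RA" "RA ** RA = transpose UA ** A ** UA"
      "posdef RB" "RB ** RB = transpose UB ** B ** UB"
    and M: "M = midpoint_frame UA UB \<theta>
        ** (RA ** psd_sqrt (matrix_inv RA ** (RB ** RB) ** matrix_inv RA) ** RA)
        ** transpose (midpoint_frame UA UB \<theta>)"
    unfolding is_geometric_mean_midpoint by blast
  have "M = mean_in_frames A B UA UB \<theta>"
    using posdef_frame_compressions[OF A B f] R
    by (simp add: M mean_in_frames_def spd_mean_root_formula)
  with f show "\<exists>(UA :: real^('p::{finite,linorder})^'n) UB \<theta>.
      principal_frames A B UA UB \<theta> \<and> M = mean_in_frames A B UA UB \<theta>" by blast
next
  assume "\<exists>(UA :: real^('p::{finite,linorder})^'n) UB \<theta>.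
      principal_frames A B UA UB \<theta> \<and> M = mean_in_frames A B UA UB \<theta>"
  then obtain UA UB :: "real^('p::{finite,linorder})^'n" and \<theta> where
    f: "principal_frames A B UA UB \<theta>" and M: "M = mean_in_frames A B UA UB \<theta>" by blast
  note pd = posdef_frame_compressions[OF A B f]
  obtain RA where RA: "posdef RA" "RA ** RA = transpose UA ** A ** UA"
    using posdef_square_root_exists[OF pd(1)] by metis
  obtain RB where RB: "posdef RB" "RB ** RB = transpose UB ** B ** UB"
    using posdef_square_root_exists[OF pd(2)] by metis
  have "M = midpoint_frame UA UB \<theta>
      ** (RA ** psd_sqrt (matrix_inv RA ** (RB ** RB) ** matrix_inv RA) ** RA)
      ** transpose (midpoint_frame UA UB \<theta>)"
    using pd(2) by (simp add: M mean_in_frames_def spd_mean_root_formula RA RB)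
  then show "is_geometric_mean TYPE('p::{finite,linorder}) A B M"
    unfolding is_geometric_mean_midpoint using f RA RB by blast
qed

text \<open>
  Let \<open>Q\<close> and \<open>Q'\<close> be the changes of frame, so that \<open>Q\<^sup>T D Q' = D\<close> for the diagonal matrix \<open>D\<close> of
  cosines. Comparing entries of \<open>D Q' = Q D\<close> and its transposed counterpart \<open>D Q = Q' D\<close> gives
  \<open>c\<^sub>i\<^sup>2 q\<^sub>i\<^sub>j = q\<^sub>i\<^sub>j c\<^sub>j\<^sup>2\<close>. As the cosines are positive, \<open>Q\<close> only mixes indices of equal
  angle, \<open>Q' = Q\<close>, and \<open>Q\<close> commutes with every diagonal matrix that depends on the angles only. Thus the
  midpoint frame turns into \<open>W Q\<close> and the core into \<open>Q\<^sup>T K Q\<close>, and the product \<open>W K W\<^sup>T\<close> is unchanged. For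
  a right angle the argument breaks down, since \<open>Q\<close> and \<open>Q'\<close> are then independent on its block.
\<close>

lemma mean_in_frames_independent:
  fixes A B :: "real^'n^'n" and UA UB UA' UB' :: "real^('p::{finite,linorder})^'n"
  assumes A: "psd A" and B: "psd B"
    and f: "principal_frames A B UA UB \<theta>" and f': "principal_frames A B UA' UB' \<theta>'"
    and acute: "\<And>i. \<theta> $ i < pi / 2"
  shows "mean_in_frames A B UA' UB' \<theta>' = mean_in_frames A B UA UB \<theta>"
proof -
  define D where "D = diag (\<chi> i. cos (\<theta> $ i))"
  obtain Q Q' where Q: "orthogonal_matrix Q" "orthogonal_matrix Q'"
    and U': "UA' = UA ** Q" "UB' = UB ** Q'" and "\<theta>' = \<theta>"
    and eq: "transpose Q ** D ** Q' = D"
    using principal_frames_change[OF f f'] unfolding D_def by metis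
  have QQ: "Q ** transpose Q = mat 1" "transpose Q' ** Q' = mat 1"
    "transpose Q ** Q = mat 1" "Q' ** transpose Q' = mat 1"
    using Q by (simp_all add: orthogonal_matrix_def)
  have DQ': "D ** Q' = Q ** D"
  proof -
    have "Q ** D = Q ** (transpose Q ** D ** Q')" by (simp add: eq)
    also have "\<dots> = D ** Q'" by (simp add: matrix_mul_assoc QQ)
    finally show ?thesis by simp
  qed
  have DQ: "D ** Q = Q' ** D"
  proof -
    have "transpose (transpose Q ** D ** Q') = D" by (simp add: eq) (simp add: D_def)
    then have "D = transpose Q' ** D ** Q" by (simp add: matrix_transpose_mul matrix_mul_assoc D_def)
    then have "Q' ** D = Q' ** (transpose Q' ** D ** Q)" by simp
    also have "\<dots> = D ** Q" by (simp add: matrix_mul_assoc QQ)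
    finally show ?thesis by simp
  qed
  have t: "0 \<le> \<theta> $ i" "\<theta> $ i \<le> pi" for i
    using f acute[of i] pi_gt_zero by (auto simp: principal_frames_iff less_imp_le)
  have pos: "0 < cos (\<theta> $ i)" for i
    using acute[of i] t(1)[of i] by (intro cos_gt_zero_pi) linarith+
  have e1: "cos (\<theta> $ i) * Q' $ i $ j = Q $ i $ j * cos (\<theta> $ j)" for i j
    using arg_cong[OF DQ', of "\<lambda>M. M $ i $ j"] by (simp add: D_def diag_mul_nth mul_diag_nth)
  have e2: "cos (\<theta> $ i) * Q $ i $ j = Q' $ i $ j * cos (\<theta> $ j)" for i j
    using arg_cong[OF DQ, of "\<lambda>M. M $ i $ j"] by (simp add: D_def diag_mul_nth mul_diag_nth)
  have same_angle: "\<theta> $ i = \<theta> $ j" if "Q $ i $ j \<noteq> 0" for i j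
  proof -
    have "(cos (\<theta> $ i))^2 * Q $ i $ j = (cos (\<theta> $ j))^2 * Q $ i $ j"
    proof -
      have "(cos (\<theta> $ i))^2 * Q $ i $ j = cos (\<theta> $ i) * (cos (\<theta> $ i) * Q $ i $ j)"
        by (simp add: power2_eq_square)
      also have "\<dots> = (cos (\<theta> $ i) * Q' $ i $ j) * cos (\<theta> $ j)" by (simp add: e2)
      also have "\<dots> = (cos (\<theta> $ j))^2 * Q $ i $ j" by (simp add: e1 power2_eq_square)
      finally show ?thesis .
    qed
    then have "cos (\<theta> $ i) = cos (\<theta> $ j)"
      using that pos[of i] pos[of j] by (simp add: power2_eq_iff_nonneg less_imp_le)
    then show ?thesis using t by (metis arccos_cos)
  qed
  have "Q' $ i $ j = Q $ i $ j" for i j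
  proof (cases "Q $ i $ j = 0")
    case True
    then show ?thesis using e1[of i j] pos[of i] by simp
  next
    case False
    then show ?thesis using e1[of i j] pos[of i] same_angle[OF False] by simp
  qed
  then have "Q' = Q" by (simp add: vec_eq_iff)
  define E where "E = diag (\<chi> i. 1 / (2 * cos (\<theta> $ i / 2)))"
  have "(Q ** E) $ i $ j = (E ** Q) $ i $ j" for i j
    using same_angle[of i j] by (cases "Q $ i $ j = 0") (auto simp: E_def diag_mul_nth mul_diag_nth)
  then have QE: "Q ** E = E ** Q" by (simp add: vec_eq_iff)
  have W: "midpoint_frame UA' UB' \<theta>' = midpoint_frame UA UB \<theta> ** Q"
  proof -
    have "midpoint_frame UA' UB' \<theta>' = (UA + UB) ** (Q ** E)"
      by (simp add: midpoint_frame_def U' \<open>Q' = Q\<close> \<open>\<theta>' = \<theta>\<close> E_def matrix_mul_add_distrib matrix_mul_assoc)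
    also have "\<dots> = (UA + UB) ** (E ** Q)" by (simp only: QE)
    also have "\<dots> = midpoint_frame UA UB \<theta> ** Q"
      by (simp add: midpoint_frame_def E_def matrix_mul_assoc)
    finally show ?thesis .
  qed
  have "spd_mean (transpose UA' ** A ** UA') (transpose UB' ** B ** UB')
      = transpose Q ** spd_mean (transpose UA ** A ** UA) (transpose UB ** B ** UB) ** Q"
    using spd_mean_orthogonal_congruence[OF posdef_frame_compressions[OF A B f] Q(1)]
    by (simp add: U' \<open>Q' = Q\<close> matrix_transpose_mul matrix_mul_assoc)
  then show ?thesis
    by (simp add: mean_in_frames_def W matrix_transpose_mul matrix_mul_assoc
        matrix_mul_cancel_right[OF QQ(1)])
qed

theorem geometric_mean_eq_mean_in_frames:
  fixes A B :: "real^'n^'n" and UA UB :: "real^('p::{finite,linorder})^'n"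
  assumes A: "psd A" and B: "psd B" and f: "principal_frames A B UA UB \<theta>"
    and acute: "\<And>i. \<theta> $ i < pi / 2"
  shows "geometric_mean TYPE('p::{finite,linorder}) A B = mean_in_frames A B UA UB \<theta>"
  unfolding geometric_mean_def is_geometric_mean_iff[OF A B]
  by (rule the_equality) (use f mean_in_frames_independent[OF A B f _ acute] in blast)+

lemma acute_principal_frames_exist:
  fixes A B :: "real^'n^'n"
  assumes "rank A = CARD('p::{finite,linorder})" "rank B = CARD('p)"
    and "largest_principal_angle TYPE('p) A B \<noteq> pi / 2"
  obtains UA UB :: "real^('p::{finite,linorder})^'n" and \<theta>
    where "principal_frames A B UA UB \<theta>" "\<And>i. \<theta> $ i < pi / 2"
proof -
  obtain UA UB :: "real^('p::{finite,linorder})^'n" and \<theta> where f: "principal_frames A B UA UB \<theta>"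
    using principal_frames_exist[OF assms(1,2)] by blast
  have "\<theta> $ Max UNIV \<noteq> pi / 2"
    using assms(3) principal_angles_eq[OF f] by (simp add: largest_principal_angle_def)
  moreover have "\<theta> $ Max UNIV \<le> pi / 2" using f by (simp add: principal_frames_iff)
  ultimately have "\<theta> $ Max UNIV < pi / 2" by simp
  moreover have "\<theta> $ i \<le> \<theta> $ Max UNIV" for i
    using f by (simp add: principal_frames_iff)
  ultimately have "\<theta> $ i < pi / 2" for i by (rule order.strict_trans1[rotated])
  with f show thesis by (rule that)
qed

section \<open>Properties of the geometric mean\<close>

lemma range_scaleR:
  fixes M :: "real^'n^'m"
  assumes "c \<noteq> 0"
  shows "range (\<lambda>x. (c *\<^sub>R M) *v x) = range (\<lambda>x. M *v x)"
  using range_mul_right_surj[of "c *\<^sub>R mat 1 :: real^'n^'n" "(1 / c) *\<^sub>R mat 1" M] assms by simp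

lemma principal_frames_scaleR:
  assumes "a \<noteq> 0" "b \<noteq> 0"
  shows "principal_frames (a *\<^sub>R A) (b *\<^sub>R B) UA UB \<theta> \<longleftrightarrow> principal_frames A B UA UB \<theta>"
  by (rule principal_frames_cong[OF range_scaleR[OF assms(1)] range_scaleR[OF assms(2)]])

lemma geometric_mean_scaleR:
  fixes A B :: "real^'n^'n" and UA UB :: "real^('p::{finite,linorder})^'n"
  assumes A: "psd A" and B: "psd B" and f: "principal_frames A B UA UB \<theta>"
    and acute: "\<And>i. \<theta> $ i < pi / 2" and pos: "0 < a" "0 < b"
  shows "geometric_mean TYPE('p::{finite,linorder}) (a *\<^sub>R A) (b *\<^sub>R B)
    = sqrt (a * b) *\<^sub>R geometric_mean TYPE('p) A B"
proof -
  have "psd (a *\<^sub>R A)" "psd (b *\<^sub>R B)" using A B pos by (simp_all add: psd_scaleR)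
  moreover have "principal_frames (a *\<^sub>R A) (b *\<^sub>R B) UA UB \<theta>"
    using f pos by (simp add: principal_frames_scaleR)
  ultimately have "geometric_mean TYPE('p) (a *\<^sub>R A) (b *\<^sub>R B)
      = mean_in_frames (a *\<^sub>R A) (b *\<^sub>R B) UA UB \<theta>"
    using acute by (rule geometric_mean_eq_mean_in_frames)
  also have "\<dots> = sqrt (a * b) *\<^sub>R mean_in_frames A B UA UB \<theta>"
    using pos posdef_frame_compressions[OF A B f] by (simp add: mean_in_frames_def spd_mean_scaleR)
  finally show ?thesis by (simp add: geometric_mean_eq_mean_in_frames[OF A B f acute])
qed

lemma geometric_mean_commute:
  fixes A B :: "real^'n^'n" and UA UB :: "real^('p::{finite,linorder})^'n"
  assumes A: "psd A" and B: "psd B" and f: "principal_frames A B UA UB \<theta>"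
    and acute: "\<And>i. \<theta> $ i < pi / 2"
  shows "geometric_mean TYPE('p::{finite,linorder}) A B = geometric_mean TYPE('p) B A"
  using geometric_mean_eq_mean_in_frames[OF A B f acute]
    geometric_mean_eq_mean_in_frames[OF B A principal_frames_swap[OF f] acute]
    spd_mean_commute[OF posdef_frame_compressions[OF A B f]]
  by (simp add: mean_in_frames_def midpoint_frame_commute)

text \<open>
  The larger matrices have the same ranges and therefore the same frames and angles, so the comparison
  takes place entirely between the positive definite compressions.
\<close>

lemma geometric_mean_mono:
  fixes A B :: "real^'n^'n" and UA UB :: "real^('p::{finite,linorder})^'n"
  assumes A: "psd A" and B: "psd B" and f: "principal_frames A B UA UB \<theta>"
    and acute: "\<And>i. \<theta> $ i < pi / 2"
    and A': "psd A'" "rank A = rank A'" "loewner_le A A'"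
    and B': "psd B'" "rank B = rank B'" "loewner_le B B'"
  shows "principal_frames A' B' UA UB \<theta>"
    and "loewner_le (geometric_mean TYPE('p::{finite,linorder}) A B) (geometric_mean TYPE('p) A' B')"
proof -
  show f': "principal_frames A' B' UA UB \<theta>"
    using f principal_frames_cong loewner_le_same_rank_imp_same_range A B A' B' by metis
  let ?W = "midpoint_frame UA UB \<theta>"
  let ?K = "spd_mean (transpose UA ** A ** UA) (transpose UB ** B ** UB)"
  let ?K' = "spd_mean (transpose UA ** A' ** UA) (transpose UB ** B' ** UB)"
  have compress: "loewner_le (transpose U ** M ** U) (transpose U ** M' ** U)"
    if "loewner_le M M'" for M M' :: "real^'n^'n" and U :: "real^('p::{finite,linorder})^'n"
    using psd_congruence[of "M' - M" U] that by (simp add: loewner_le_def matrix_mul_diff_distrib)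
  have "loewner_le ?K ?K'"
    using A' B' posdef_frame_compressions[OF A B f] posdef_frame_compressions[OF A'(1) B'(1) f']
    by (intro spd_mean_mono compress) simp_all
  then have "psd (transpose (transpose ?W) ** (?K' - ?K) ** transpose ?W)"
    unfolding loewner_le_def by (rule psd_congruence)
  then show "loewner_le (geometric_mean TYPE('p::{finite,linorder}) A B) (geometric_mean TYPE('p) A' B')"
    by (simp add: geometric_mean_eq_mean_in_frames[OF A B f acute]
        geometric_mean_eq_mean_in_frames[OF A'(1) B'(1) f' acute]
        loewner_le_def mean_in_frames_def matrix_mul_diff_distrib)
qed

lemma geometric_mean_orthogonal_congruence:
  fixes A B P :: "real^'n^'n" and UA UB :: "real^('p::{finite,linorder})^'n"
  assumes A: "psd A" and B: "psd B" and f: "principal_frames A B UA UB \<theta>"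
    and acute: "\<And>i. \<theta> $ i < pi / 2" and P: "orthogonal_matrix P"
  shows "geometric_mean TYPE('p::{finite,linorder}) (transpose P ** A ** P) (transpose P ** B ** P)
    = transpose P ** geometric_mean TYPE('p) A B ** P"
proof -
  have PP: "P ** transpose P = mat 1" using P by (simp add: orthogonal_matrix_def)
  have rng: "range (\<lambda>x. (transpose P ** U) *v x) = range (\<lambda>x. (transpose P ** M ** P) *v x)"
    if "range (\<lambda>x. U *v x) = range (\<lambda>x. M *v x)"
    for U :: "real^('p::{finite,linorder})^'n" and M :: "real^'n^'n"
  proof -
    have image: "range (\<lambda>x. (transpose P ** N) *v x) = (\<lambda>y. transpose P *v y) ` range (\<lambda>x. N *v x)"
      for N :: "real^'k^'n"
      by (simp add: image_image flip: matrix_vector_mul_assoc)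
    show ?thesis
      unfolding range_mul_right_surj[OF PP, of "transpose P ** M"] image that ..
  qed
  have f': "principal_frames (transpose P ** A ** P) (transpose P ** B ** P)
      (transpose P ** UA) (transpose P ** UB) \<theta>"
    using f by (simp add: principal_frames_iff rng matrix_transpose_mul matrix_mul_assoc
        matrix_mul_cancel_right[OF PP])
  have W: "midpoint_frame (transpose P ** UA) (transpose P ** UB) \<theta> = transpose P ** midpoint_frame UA UB \<theta>"
    by (simp add: midpoint_frame_def matrix_mul_add_distrib matrix_mul_assoc)
  show ?thesis
    by (simp add: geometric_mean_eq_mean_in_frames[OF A B f acute]
        geometric_mean_eq_mean_in_frames[OF psd_congruence[OF A] psd_congruence[OF B] f' acute]
        mean_in_frames_def W matrix_transpose_mul matrix_mul_assoc matrix_mul_cancel_right[OF PP])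
qed

text \<open>
  All three claims are read off from \<open>A = U G U\<^sup>T\<close>, whose pseudoinverse is \<open>U G\<^sup>-\<^sup>1 U\<^sup>T\<close>.
\<close>

lemma pseudoinverse_psd_in_frame:
  fixes U :: "real^('p::finite)^'n"
  assumes A: "psd A" and U: "transpose U ** U = mat 1" "range (\<lambda>x. U *v x) = range (\<lambda>x. A *v x)"
  shows "psd (pseudoinverse A)" "range (\<lambda>x. pseudoinverse A *v x) = range (\<lambda>x. A *v x)"
    "transpose U ** pseudoinverse A ** U = matrix_inv (transpose U ** A ** U)"
proof -
  define G where "G = transpose U ** A ** U"
  have G: "posdef G" and A_eq: "A = U ** G ** transpose U"
    unfolding G_def using posdef_compression[OF A U] by simp_all
  have pinv: "pseudoinverse A = U ** matrix_inv G ** transpose U"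
    unfolding A_eq by (rule pseudoinverse_in_frame[OF U(1) G])
  show "psd (pseudoinverse A)"
    using psd_congruence[OF posdef_imp_psd[OF posdef_matrix_inv[OF G]], of "transpose U"]
    by (simp add: pinv)
  show "range (\<lambda>x. pseudoinverse A *v x) = range (\<lambda>x. A *v x)"
    unfolding pinv range_in_frame[OF U(1) posdef_inverse(2)[OF G]] by (rule U(2))
  show "transpose U ** pseudoinverse A ** U = matrix_inv (transpose U ** A ** U)"
    by (simp add: pinv matrix_mul_assoc matrix_mul_cancel_right[OF U(1)] U(1) flip: G_def)
qed

text \<open>
  Both sides are expressed in one common midpoint frame, whose columns are orthonormal, so that
  pseudoinversion of \<open>W K W\<^sup>T\<close> amounts to inversion of \<open>K\<close>.
\<close>

lemma geometric_mean_pseudoinverse: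
  fixes A B :: "real^'n^'n" and UA UB :: "real^('p::{finite,linorder})^'n"
  assumes A: "psd A" and B: "psd B" and f: "principal_frames A B UA UB \<theta>"
    and acute: "\<And>i. \<theta> $ i < pi / 2"
  shows "pseudoinverse (geometric_mean TYPE('p::{finite,linorder}) A B)
    = geometric_mean TYPE('p) (pseudoinverse A) (pseudoinverse B)"
proof -
  have U: "transpose UA ** UA = mat 1" "range (\<lambda>x. UA *v x) = range (\<lambda>x. A *v x)"
    "transpose UB ** UB = mat 1" "range (\<lambda>x. UB *v x) = range (\<lambda>x. B *v x)"
    using f by (simp_all add: principal_frames_iff)
  note pA = pseudoinverse_psd_in_frame[OF A U(1,2)]
  note pB = pseudoinverse_psd_in_frame[OF B U(3,4)]
  note pd = posdef_frame_compressions[OF A B f]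
  have f': "principal_frames (pseudoinverse A) (pseudoinverse B) UA UB \<theta>"
    using f by (simp add: principal_frames_iff pA pB)
  have "pseudoinverse (geometric_mean TYPE('p::{finite,linorder}) A B)
      = midpoint_frame UA UB \<theta>
        ** matrix_inv (spd_mean (transpose UA ** A ** UA) (transpose UB ** B ** UB))
        ** transpose (midpoint_frame UA UB \<theta>)"
    unfolding geometric_mean_eq_mean_in_frames[OF A B f acute] mean_in_frames_def
    by (rule pseudoinverse_in_frame[OF midpoint_frame_orthonormal[OF f] spd_mean_riccati(1)[OF pd]])
  also have "\<dots> = geometric_mean TYPE('p) (pseudoinverse A) (pseudoinverse B)"
    unfolding geometric_mean_eq_mean_in_frames[OF pA(1) pB(1) f' acute] mean_in_frames_def
      pA(3) pB(3) spd_mean_inverse[OF pd] ..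
  finally show ?thesis .
qed

theorem proposition4:
  fixes A B :: "real^'n^'n"
  assumes "CARD('p::{finite,linorder}) < CARD('n)"
    and "A \<in> spsd_of_rank CARD('p)" and "B \<in> spsd_of_rank CARD('p)"
    and "largest_principal_angle TYPE('p) A B \<noteq> pi / 2"
  shows
    "(\<forall>\<alpha>>0. \<forall>\<beta>>0.
        geometric_mean TYPE('p) (\<alpha> *\<^sub>R A) (\<beta> *\<^sub>R B)
          = sqrt (\<alpha> * \<beta>) *\<^sub>R geometric_mean TYPE('p) A B) \<and>
     geometric_mean TYPE('p) A B = geometric_mean TYPE('p) B A \<and>
     (\<forall>A\<^sub>0\<in>spsd_of_rank CARD('p). \<forall>B\<^sub>0\<in>spsd_of_rank CARD('p).
        loewner_le A A\<^sub>0 \<and> loewner_le B B\<^sub>0 \<longrightarrow>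
          largest_principal_angle TYPE('p) A\<^sub>0 B\<^sub>0 \<noteq> pi / 2 \<and>
          loewner_le (geometric_mean TYPE('p) A B) (geometric_mean TYPE('p) A\<^sub>0 B\<^sub>0)) \<and>
     (\<forall>\<mu> P. \<mu> \<noteq> 0 \<and> orthogonal_matrix P \<longrightarrow>
        geometric_mean TYPE('p) ((\<mu> *\<^sub>R transpose P) ** A ** (\<mu> *\<^sub>R P))
                                ((\<mu> *\<^sub>R transpose P) ** B ** (\<mu> *\<^sub>R P))
          = (\<mu> *\<^sub>R transpose P) ** geometric_mean TYPE('p) A B ** (\<mu> *\<^sub>R P)) \<and>
     pseudoinverse (geometric_mean TYPE('p) A B)
       = geometric_mean TYPE('p) (pseudoinverse A) (pseudoinverse B)"
proof -
  have A: "psd A" "rank A = CARD('p)" and B: "psd B" "rank B = CARD('p)"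
    using assms(2,3) by (simp_all add: spsd_of_rank_def)
  obtain UA UB :: "real^('p::{finite,linorder})^'n" and \<theta>
    where f: "principal_frames A B UA UB \<theta>" and acute: "\<And>i. \<theta> $ i < pi / 2"
    using acute_principal_frames_exist[OF A(2) B(2) assms(4)] by blast
  note ctx = A(1) B(1) f acute
  show ?thesis
  proof (intro conjI allI ballI impI)
    show "geometric_mean TYPE('p) (\<alpha> *\<^sub>R A) (\<beta> *\<^sub>R B)
        = sqrt (\<alpha> * \<beta>) *\<^sub>R geometric_mean TYPE('p) A B" if "0 < \<alpha>" "0 < \<beta>" for \<alpha> \<beta>
      using that by (rule geometric_mean_scaleR[OF ctx])
    show "geometric_mean TYPE('p) A B = geometric_mean TYPE('p) B A"
      by (rule geometric_mean_commute[OF ctx])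
    fix A\<^sub>0 B\<^sub>0 :: "real^'n^'n"
    assume *: "A\<^sub>0 \<in> spsd_of_rank CARD('p)" "B\<^sub>0 \<in> spsd_of_rank CARD('p)"
      "loewner_le A A\<^sub>0 \<and> loewner_le B B\<^sub>0"
    have "psd A\<^sub>0" "rank A = rank A\<^sub>0" "loewner_le A A\<^sub>0" "psd B\<^sub>0" "rank B = rank B\<^sub>0" "loewner_le B B\<^sub>0"
      using * A(2) B(2) by (simp_all add: spsd_of_rank_def)
    note mono = geometric_mean_mono[OF ctx this]
    show "largest_principal_angle TYPE('p) A\<^sub>0 B\<^sub>0 \<noteq> pi / 2"
      using principal_angles_eq[OF mono(1)] acute[of "Max UNIV"]
      by (simp add: largest_principal_angle_def)
    show "loewner_le (geometric_mean TYPE('p) A B) (geometric_mean TYPE('p) A\<^sub>0 B\<^sub>0)"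
      by (rule mono(2))
  next
    fix \<mu> :: real and P :: "real^'n^'n"
    assume *: "\<mu> \<noteq> 0 \<and> orthogonal_matrix P"
    then have pos: "0 < \<mu> * \<mu>" by (auto simp: zero_less_mult_iff)
    show "geometric_mean TYPE('p) ((\<mu> *\<^sub>R transpose P) ** A ** (\<mu> *\<^sub>R P))
          ((\<mu> *\<^sub>R transpose P) ** B ** (\<mu> *\<^sub>R P))
        = (\<mu> *\<^sub>R transpose P) ** geometric_mean TYPE('p) A B ** (\<mu> *\<^sub>R P)"
    proof -
      have psd: "psd ((\<mu> * \<mu>) *\<^sub>R A)" "psd ((\<mu> * \<mu>) *\<^sub>R B)"
        using A B pos by (simp_all add: psd_scaleR)
      have f': "principal_frames ((\<mu> * \<mu>) *\<^sub>R A) ((\<mu> * \<mu>) *\<^sub>R B) UA UB \<theta>"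
        using f * by (simp add: principal_frames_scaleR)
      \<comment> \<open>The factor \<open>\<mu>\<close> on either side, possibly negative, is a positive scaling by \<open>\<mu>\<^sup>2\<close>.\<close>
      show ?thesis
        using geometric_mean_orthogonal_congruence[OF psd f' acute, of P] *
          geometric_mean_scaleR[OF ctx pos pos]
        by simp
    qed
  next
    show "pseudoinverse (geometric_mean TYPE('p) A B)
        = geometric_mean TYPE('p) (pseudoinverse A) (pseudoinverse B)"
      by (rule geometric_mean_pseudoinverse[OF ctx])
  qed
qed

end
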